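(* Let $B,W$ be independent standard one-dimensional Brownian motions with $W_0=0$, $B_0=x$ under $\mathbf{P}^x$. Let $\beta\in\mathbb{R}$ and real numbers $a,b,a',b',a_0,b_0$ satisfy $a<a_0\le b_0<b$ and $a\le a'<b'\le b$. For $t>0$ define $$\overline{X}_t:=-\ln\inf_{x\in[a_0,b_0]}\mathbf{P}^{x}\big(\forall_{s\in[0,t]}\ \beta W_s+a\le B_s\le \beta W_s+b,\ \beta W_t+a'\le B_t\le \beta W_t+b'\ \big|\ W\big).$$ Then for any $t>0$, $p>0$ and $q>1$, $$\lim_{n\to+\infty}n^p\,\mathbf{P}\big(\overline{X}_t\ge(\ln n)^q\big)=0.$$ Consequently, $\mathbf{E}(\overline{X}_t^{\,j})<+\infty$ for every $j\in\mathbb{N}$ and every $t>0$.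
   Context: $\mathbf{P}^x(\cdot\mid W)$ is the conditional probability given the whole path of $W$; $\overline{X}_t$ is thus a random variable depending on $W$, and $\mathbf{P},\mathbf{E}$ refer to the law of $W$. *)

theory Defs
  imports "HOL-Probability.Probability"
begin

definition std_BM :: "'a measure \<Rightarrow> (real \<Rightarrow> 'a \<Rightarrow> real) \<Rightarrow> bool" where
  "std_BM M X \<longleftrightarrow>
     prob_space M \<and>
     (\<forall>t. X t \<in> borel_measurable M) \<and>
     (\<forall>\<omega>\<in>space M. X 0 \<omega> = 0 \<and> continuous_on {0..} (\<lambda>t. X t \<omega>)) \<and>
     (\<forall>s t. 0 \<le> s \<and> s < t \<longrightarrow>
        distributed M lborel (\<lambda>\<omega>. X t \<omega> - X s \<omega>) (normal_density 0 (sqrt (t - s)))) \<and>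
     (\<forall>ts :: real list. sorted ts \<and> distinct ts \<and> (\<forall>u\<in>set ts. 0 \<le> u) \<longrightarrow>
        prob_space.indep_vars M (\<lambda>_. borel)
          (\<lambda>i \<omega>. X (ts ! Suc i) \<omega> - X (ts ! i) \<omega>) {..< length ts - 1})"

text \<open>The event, for a fixed path w of W and starting point x of B (B = x + B0,
  B0 a standard BM from 0 on the space MB).\<close>
definition tube_event ::
  "'a measure \<Rightarrow> (real \<Rightarrow> 'a \<Rightarrow> real) \<Rightarrow> (real \<Rightarrow> real) \<Rightarrow> real \<Rightarrow> real \<Rightarrow> real
    \<Rightarrow> real \<Rightarrow> real \<Rightarrow> real \<Rightarrow> real \<Rightarrow> 'a set" where
  "tube_event MB B0 w \<beta> a b a' b' x t =
     {\<omega> \<in> space MB.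
        (\<forall>s\<in>{0..t}. \<beta> * w s + a \<le> x + B0 s \<omega> \<and> x + B0 s \<omega> \<le> \<beta> * w s + b) \<and>
        \<beta> * w t + a' \<le> x + B0 t \<omega> \<and> x + B0 t \<omega> \<le> \<beta> * w t + b'}"

text \<open>Xbar_t(omega) = - ln inf_{x in [a0,b0]} P^x( event | W = W(omega) ), as an extended
  real (value +infinity when the infimum is 0).\<close>
definition Xbar ::
  "'a measure \<Rightarrow> (real \<Rightarrow> 'a \<Rightarrow> real) \<Rightarrow> (real \<Rightarrow> 'b \<Rightarrow> real) \<Rightarrow> real \<Rightarrow> real \<Rightarrow> real
    \<Rightarrow> real \<Rightarrow> real \<Rightarrow> real \<Rightarrow> real \<Rightarrow> real \<Rightarrow> 'b \<Rightarrow> ereal" where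
  "Xbar MB B0 W \<beta> a b a' b' a0 b0 t \<omega> =
     (let I = (INF x\<in>{a0..b0}. measure MB (tube_event MB B0 (\<lambda>s. W s \<omega>) \<beta> a b a' b' x t))
      in if I > 0 then ereal (- ln I) else \<infinity>)"

end

theory Submission
  imports Defs "HOL-Real_Asymp.Real_Asymp"
begin

text \<open>
  Cut \<open>[0, t]\<close> into \<open>n\<close> blocks of length \<open>\<tau> = t / n\<close> and let \<open>B\<close> follow, within distance
  \<open>sqrt \<tau>\<close>, the polygon through the points \<open>\<beta> W\<close> at the block ends, tilted linearly so that it runs
  from \<open>x\<close> to the middle of the target window. By a Girsanov estimate this has probability at least
  \<open>exp (- C (n + Q))\<close>, where \<open>Q\<close> is the sum of the squared increments of \<open>W\<close> divided by \<open>\<tau>\<close>, and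
  it keeps \<open>B\<close> in the tube as soon as \<open>W\<close> oscillates little on every block. Both the failure of the
  latter and the event \<open>Q > 4 n\<close> have probability exponentially small in \<open>n\<close>, so the extended random
  variable has an exponential tail.

  The Girsanov estimate is obtained without path measures: on dyadic grids, an exponentially tilted
  compactly supported bump is an explicit subsolution of the backward equation of the Gaussian walk
  killed outside the moving tube, with constants that do not depend on the grid.
\<close>

section \<open>Gaussian steps and the bump function\<close>

text \<open>With \<open>1 - y\<^sup>2\<close> alone the function would be strictly concave up to the
  edge of its support, and no multiple of its vanishing value could bound the second difference from
  below. The outer square makes it convex near the edge.\<close>

definition bump :: "real \<Rightarrow> real" where
  "bump y = (max 0 (1 - y\<^sup>2))\<^sup>2"

lemma bump_nonneg: "0 \<le> bump y"
  by (simp add: bump_def)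

lemma bump_le_1: "bump y \<le> 1"
  unfolding bump_def by (rule power_le_one) auto

lemma bump_0: "bump 0 = 1"
  by (simp add: bump_def)

lemma bump_minus: "bump (- y) = bump y"
  by (simp add: bump_def)

lemma bump_eq_0: "1 \<le> \<bar>y\<bar> \<Longrightarrow> bump y = 0"
  using abs_le_square_iff[of 1 y] by (simp add: bump_def)

lemma bump_eq: "\<bar>y\<bar> \<le> 1 \<Longrightarrow> bump y = (1 - y\<^sup>2)\<^sup>2"
  using abs_le_square_iff[of y 1] by (simp add: bump_def)

lemma borel_measurable_bump [measurable]: "bump \<in> borel_measurable borel"
  unfolding bump_def[abs_def] by measurable

text \<open>This inequality replaces concavity: it makes the bump a subsolution of the heat equation
  up to an exponential rate, for arbitrarily coarse symmetric steps.\<close>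

lemma bump_second_difference:
  "2 * (1 - 16 * z\<^sup>2) * bump y \<le> bump (y + z) + bump (y - z)"
proof -
  have main: "2 * (1 - 16 * z\<^sup>2) * bump y \<le> bump (y + z) + bump (y - z)"
    if y: "0 \<le> y" and z: "0 \<le> z" for y z :: real
  proof -
    \<comment> \<open>The constant 16 makes the left side nonpositive once \<open>z\<close> reaches
      1/4, and for \<open>1 \<le> y\<close> it is zero; only short steps from inside the support
      need a computation.\<close>
    consider "1 \<le> y" | "1/4 \<le> z" | "y < 1" "z < 1/4" by linarith
    then show ?thesis
    proof cases
      case 1
      then show ?thesis using y by (simp add: bump_eq_0 bump_nonneg add_nonneg_nonneg)
    next
      case 2
      then have "(1/4)\<^sup>2 \<le> z\<^sup>2" by (intro power_mono) auto
      then have "2 * (1 - 16 * z\<^sup>2) \<le> 0" by (simp add: power2_eq_square)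
      then have "2 * (1 - 16 * z\<^sup>2) * bump y \<le> 0" by (rule mult_nonpos_nonneg[OF _ bump_nonneg])
      then show ?thesis using bump_nonneg[of "y+z"] bump_nonneg[of "y-z"] by linarith
    next
      case 3
      have eqs: "bump y = (1 - y\<^sup>2)\<^sup>2" "bump (y - z) = (1 - (y - z)\<^sup>2)\<^sup>2"
        using 3 y z by (auto intro!: bump_eq)
      show ?thesis
      proof (cases "y + z \<le> 1")
        case True
        then have e: "bump (y + z) = (1 - (y + z)\<^sup>2)\<^sup>2" using y z by (intro bump_eq) auto
        \<comment> \<open>All three points lie in the support, so this is a polynomial identity. The
          quadratic in \<open>1 - y\<^sup>2\<close> on the right has negative discriminant.\<close>
        have "bump (y + z) + bump (y - z) - 2 * (1 - 16 * z\<^sup>2) * bump y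
          = z\<^sup>2 * (8 - 12 * (1 - y\<^sup>2) + 32 * (1 - y\<^sup>2)\<^sup>2 + 2 * z\<^sup>2)"
          unfolding e eqs by (simp add: power2_eq_square algebra_simps)
        moreover have "8 - 12 * (1 - y\<^sup>2) + 32 * (1 - y\<^sup>2)\<^sup>2
            = 32 * ((1 - y\<^sup>2) - 3/16)\<^sup>2 + (8 - 9/8)"
          by (simp add: power2_eq_square algebra_simps)
        then have "0 \<le> 8 - 12 * (1 - y\<^sup>2) + 32 * (1 - y\<^sup>2)\<^sup>2" by simp
        ultimately have "0 \<le> bump (y + z) + bump (y - z) - 2 * (1 - 16 * z\<^sup>2) * bump y"
          by simp
        then show ?thesis by linarith
      next
        case False
        \<comment> \<open>Here \<open>u\<close> is the distance to the edge and \<open>y + z\<close>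
          has left the support. The point \<open>y - z\<close> moves inward by more than
          \<open>u\<close>, which alone raises the bump by a factor of at least 9/4.\<close>
        define u where "u = 1 - y"
        have u: "0 < u" "u < z" using False 3 by (auto simp: u_def)
        have "3/2 * (1 - y\<^sup>2) = u * (3/2 * (2 - u))"
          by (simp add: u_def power2_eq_square algebra_simps)
        also have "\<dots> \<le> u * (2 * (2 - u - z))"
          using 3 u by (intro mult_left_mono) auto
        also have "\<dots> = (2 * u) * (2 - u - z)" by simp
        also have "\<dots> \<le> (u + z) * (2 - u - z)" using u 3 by (intro mult_right_mono) auto
        also have "\<dots> = 1 - (y - z)\<^sup>2" by (simp add: u_def power2_eq_square algebra_simps)
        finally have le: "3/2 * (1 - y\<^sup>2) \<le> 1 - (y - z)\<^sup>2" .
        have "0 \<le> 1 - y\<^sup>2" using 3 y by (simp add: power_le_one)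
        then have "(3/2 * (1 - y\<^sup>2))\<^sup>2 \<le> bump (y - z)"
          unfolding eqs using le by (intro power_mono) auto
        then have "(3/2)\<^sup>2 * bump y \<le> bump (y - z)"
          by (simp only: eqs power_mult_distrib)
        then have "9/4 * bump y \<le> bump (y - z)" by (simp add: power2_eq_square)
        moreover have "2 * (1 - 16 * z\<^sup>2) * bump y \<le> 9/4 * bump y"
          by (rule mult_right_mono[OF _ bump_nonneg]) (simp add: algebra_simps)
        ultimately show ?thesis using bump_nonneg[of "y+z"] by linarith
      qed
    qed
  qed
  have b: "bump (- y + z) = bump (y - z)" "bump (- y - z) = bump (y + z)"
    using bump_minus[of "y-z"] bump_minus[of "y+z"] by (simp_all add: algebra_simps)
  show ?thesis
    using main[of y z] main[of "-y" z] main[of y "-z"] main[of "-y" "-z"] b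
    by (cases "0 \<le> y"; cases "0 \<le> z") (simp_all add: bump_minus add.commute)
qed

section \<open>One-step Gaussian integrals and the exponential tilt\<close>

definition gauss :: "real \<Rightarrow> real measure" where
  "gauss h = density lborel (normal_density 0 (sqrt h))"

lemma space_gauss [simp]: "space (gauss h) = UNIV"
  and sets_gauss [simp, measurable_cong]: "sets (gauss h) = sets borel"
  by (simp_all add: gauss_def)

lemma prob_space_gauss: "0 < h \<Longrightarrow> prob_space (gauss h)"
  unfolding gauss_def by (rule prob_space_normal_density) simp

lemma nn_integral_gauss:
  assumes [measurable]: "f \<in> borel_measurable borel"
  shows "(\<integral>\<^sup>+z. f z \<partial>gauss h) = (\<integral>\<^sup>+z. ennreal (normal_density 0 (sqrt h) z) * f z \<partial>lborel)"
  unfolding gauss_def by (subst nn_integral_density) auto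

lemma nn_integral_gauss_minus:
  assumes [measurable]: "f \<in> borel_measurable borel"
  shows "(\<integral>\<^sup>+z. f (- z) \<partial>gauss h) = (\<integral>\<^sup>+z. f z \<partial>gauss h)"
  by (subst (1 2) nn_integral_gauss, simp, simp,
      subst nn_integral_real_affine[where t=0 and c="-1"]) (simp_all add: normal_density_def)

text \<open>Cameron-Martin formula for one step: completing the square turns the weight
  \<open>exp (v * z)\<close> into a shift of the mean by \<open>v * h\<close>.\<close>

lemma nn_integral_gauss_tilt:
  assumes [measurable]: "f \<in> borel_measurable borel" and h: "0 < h"
  shows "(\<integral>\<^sup>+z. ennreal (exp (v * z)) * f z \<partial>gauss h)
       = ennreal (exp (v\<^sup>2 * h / 2)) * (\<integral>\<^sup>+z. f (z + v * h) \<partial>gauss h)"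
proof -
  have e: "normal_density 0 (sqrt h) (v * h + z) * exp (v * (v * h + z))
      = exp (v\<^sup>2 * h / 2) * normal_density 0 (sqrt h) z" for z
  proof -
    have "- (v * h + z)\<^sup>2 / (2 * h) + v * (v * h + z) = v\<^sup>2 * h / 2 + - z\<^sup>2 / (2 * h)"
      using h by (simp add: field_simps power2_eq_square)
    then have "exp (- (v * h + z)\<^sup>2 / (2 * h)) * exp (v * (v * h + z))
        = exp (v\<^sup>2 * h / 2) * exp (- z\<^sup>2 / (2 * h))"
      by (simp only: exp_add[symmetric])
    then show ?thesis using h by (simp add: normal_density_def)
  qed
  have "(\<integral>\<^sup>+z. ennreal (exp (v * z)) * f z \<partial>gauss h)
      = (\<integral>\<^sup>+z. ennreal (normal_density 0 (sqrt h) z * exp (v * z)) * f z \<partial>lborel)"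
    by (subst nn_integral_gauss) (simp_all add: ennreal_mult mult.assoc)
  also have "\<dots> = (\<integral>\<^sup>+z. ennreal (normal_density 0 (sqrt h) (v * h + z) * exp (v * (v * h + z)))
      * f (v * h + z) \<partial>lborel)"
    by (subst nn_integral_real_affine[where t="v * h" and c=1]) simp_all
  also have "\<dots> = (\<integral>\<^sup>+z. ennreal (exp (v\<^sup>2 * h / 2)) *
      (ennreal (normal_density 0 (sqrt h) z) * f (z + v * h)) \<partial>lborel)"
    unfolding e by (simp add: ennreal_mult mult.assoc add.commute)
  also have "\<dots> = ennreal (exp (v\<^sup>2 * h / 2)) *
      (\<integral>\<^sup>+z. ennreal (normal_density 0 (sqrt h) z) * f (z + v * h) \<partial>lborel)"
    by (rule nn_integral_cmult) simp
  finally show ?thesis by (simp add: nn_integral_gauss)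
qed

lemma nn_integral_gauss_power2:
  assumes "0 < h"
  shows "(\<integral>\<^sup>+z. ennreal (z\<^sup>2) \<partial>gauss h) = ennreal h"
proof -
  have "has_bochner_integral lborel (\<lambda>z. normal_density 0 (sqrt h) z * (z - 0) ^ (2 * 1))
      (fact (2 * 1) / ((2 / (sqrt h)\<^sup>2) ^ 1 * fact 1))"
    using assms by (intro normal_moment_even) simp
  then have "has_bochner_integral lborel (\<lambda>z. normal_density 0 (sqrt h) z * z\<^sup>2) h"
    using assms by simp
  then have "(\<integral>\<^sup>+z. ennreal (normal_density 0 (sqrt h) z * z\<^sup>2) \<partial>lborel) = ennreal h"
    by (intro nn_integral_has_integral_lebesgue[THEN trans] nn_integral_eq_integral[THEN trans])
       (auto simp: has_bochner_integral_iff)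
  then show ?thesis by (subst nn_integral_gauss) (simp_all add: ennreal_mult)
qed

text \<open>By symmetry of the Gaussian law the integral is the average over \<open>y + z\<close>
  and \<open>y - z\<close>, so the second difference bound applies pointwise and
  \<open>z\<^sup>2\<close> integrates to \<open>h\<close>.\<close>

lemma nn_integral_gauss_bump:
  assumes h: "0 < h" and r: "0 < r"
  shows "ennreal ((1 - 16 * h / r\<^sup>2) * bump (y / r)) \<le> (\<integral>\<^sup>+z. ennreal (bump ((y + z) / r)) \<partial>gauss h)"
proof -
  interpret prob_space "gauss h" using h by (rule prob_space_gauss)
  define I where "I = (\<integral>\<^sup>+z. ennreal (bump ((y + z) / r)) \<partial>gauss h)"
  have "I \<le> (\<integral>\<^sup>+z. 1 \<partial>gauss h)"
    unfolding I_def by (intro nn_integral_mono) (simp add: bump_le_1)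
  also have "\<dots> = 1" using emeasure_space_1 by simp
  finally have "I < \<infinity>" by (rule order_le_less_trans) simp
  then obtain i where i: "0 \<le> i" "I = ennreal i" by (cases I) auto
  have I': "I = (\<integral>\<^sup>+z. ennreal (bump ((y - z) / r)) \<partial>gauss h)"
    unfolding I_def
    by (subst nn_integral_gauss_minus[of "\<lambda>z. ennreal (bump ((y + z) / r))", symmetric]) simp_all
  \<comment> \<open>The negative term of the second difference bound is moved to the other side with
    coefficient \<open>k\<close>, so that all integrands are nonnegative.\<close>
  define k where "k = 32 / r\<^sup>2 * bump (y / r)"
  have k: "0 \<le> k" by (simp add: bump_nonneg k_def)
  have "ennreal (2 * bump (y / r)) = (\<integral>\<^sup>+z. ennreal (2 * bump (y / r)) \<partial>gauss h)"
    using emeasure_space_1 by simp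
  also have "\<dots> \<le> (\<integral>\<^sup>+z. ennreal (bump ((y + z) / r)) + ennreal (bump ((y - z) / r))
      + ennreal k * ennreal (z\<^sup>2) \<partial>gauss h)"
  proof (intro nn_integral_mono)
    fix z
    have "2 * bump (y / r) \<le> bump ((y + z) / r) + bump ((y - z) / r) + k * z\<^sup>2"
      using bump_second_difference[of "z / r" "y / r"]
      by (simp add: k_def power_divide add_divide_distrib diff_divide_distrib algebra_simps)
    then have "ennreal (2 * bump (y / r)) \<le> ennreal (bump ((y + z) / r) + bump ((y - z) / r) + k * z\<^sup>2)"
      by (rule ennreal_leI)
    also have "\<dots> = ennreal (bump ((y + z) / r)) + ennreal (bump ((y - z) / r))
      + ennreal k * ennreal (z\<^sup>2)"
      using k by (simp add: bump_nonneg ennreal_plus ennreal_mult)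
    finally show "ennreal (2 * bump (y / r)) \<le> \<dots>" .
  qed
  also have "\<dots> = I + I + ennreal k * ennreal h"
    using h by (simp add: nn_integral_add nn_integral_cmult nn_integral_gauss_power2
        I_def[symmetric] I'[symmetric])
  also have "\<dots> = ennreal (i + i + k * h)"
    unfolding i(2) using i(1) h k by (simp flip: ennreal_plus ennreal_mult)
  finally have "2 * bump (y / r) \<le> i + i + k * h"
    using i h k by (subst (asm) ennreal_le_iff) auto
  moreover have "k * h = 2 * (16 * h / r\<^sup>2 * bump (y / r))" by (simp add: k_def)
  ultimately have "(1 - 16 * h / r\<^sup>2) * bump (y / r) \<le> i"
    unfolding left_diff_distrib by linarith
  then show ?thesis unfolding I_def[symmetric] i(2) by (rule ennreal_leI)
qed

text \<open>Turns the loss factor of each step into an exponential, so that losses over many steps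
  add up in the exponent.\<close>

lemma exp_minus_double_le:
  fixes x :: real
  assumes "0 \<le> x" "x \<le> 1/2"
  shows "exp (- (2 * x)) \<le> 1 - x"
proof -
  have "1 \<le> (1 + 2 * x) * (1 - x)"
    using mult_left_mono[OF assms(2) assms(1)] by (simp add: algebra_simps)
  also have "\<dots> \<le> exp (2 * x) * (1 - x)"
    using assms by (intro mult_right_mono) auto
  finally show ?thesis by (simp add: exp_minus field_simps)
qed

text \<open>One step of the Girsanov estimate, with three costs: \<open>v\<^sup>2 * h / 2\<close>
  for the drift, \<open>32 * h / r\<^sup>2\<close> for confinement, and
  \<open>r * \<bar>v' - v\<bar>\<close> for passing from tilt \<open>v\<close> to tilt
  \<open>v'\<close>. The shift by \<open>v * h\<close> is the motion of the tube centre.\<close>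

lemma nn_integral_gauss_tilted_bump:
  assumes h: "0 < h" and r: "0 < r" and hr: "32 * h \<le> r\<^sup>2"
  shows "ennreal (exp (- (v\<^sup>2 * h / 2 + 32 * h / r\<^sup>2 + r * \<bar>v' - v\<bar>)) * (exp (v * y) * bump (y / r)))
    \<le> (\<integral>\<^sup>+z. ennreal (exp (v' * (y + z - v * h)) * bump ((y + z - v * h) / r)) \<partial>gauss h)"
proof -
  let ?J = "exp (- (r * \<bar>v' - v\<bar>))"
  have le: "exp (- (2 * (16 * h / r\<^sup>2))) \<le> 1 - 16 * h / r\<^sup>2"
    using h r hr by (intro exp_minus_double_le) (auto simp: field_simps)
  have "exp (- (v\<^sup>2 * h / 2 + 32 * h / r\<^sup>2 + r * \<bar>v' - v\<bar>)) * (exp (v * y) * bump (y / r))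
      = ?J * exp (v * (y - v * h)) * exp (v\<^sup>2 * h / 2) * (exp (- (2 * (16 * h / r\<^sup>2))) * bump (y / r))"
  proof -
    have "- (v\<^sup>2 * h / 2 + 32 * h / r\<^sup>2 + r * \<bar>v' - v\<bar>) + v * y
      = - (r * \<bar>v' - v\<bar>) + v * (y - v * h) + v\<^sup>2 * h / 2 + - (2 * (16 * h / r\<^sup>2))"
      by (simp add: power2_eq_square algebra_simps)
    then have "exp (- (v\<^sup>2 * h / 2 + 32 * h / r\<^sup>2 + r * \<bar>v' - v\<bar>)) * exp (v * y)
      = ?J * exp (v * (y - v * h)) * exp (v\<^sup>2 * h / 2) * exp (- (2 * (16 * h / r\<^sup>2)))"
      by (simp only: exp_add[symmetric])
    then show ?thesis by (simp only: mult.assoc[symmetric])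
  qed
  also have "\<dots> \<le> ?J * exp (v * (y - v * h)) * exp (v\<^sup>2 * h / 2) * ((1 - 16 * h / r\<^sup>2) * bump (y / r))"
    by (intro mult_left_mono mult_right_mono le bump_nonneg) auto
  finally have "ennreal (exp (- (v\<^sup>2 * h / 2 + 32 * h / r\<^sup>2 + r * \<bar>v' - v\<bar>)) * (exp (v * y) * bump (y / r)))
      \<le> ennreal (?J * exp (v * (y - v * h)) * exp (v\<^sup>2 * h / 2) * ((1 - 16 * h / r\<^sup>2) * bump (y / r)))"
    by (rule ennreal_leI)
  also have "\<dots> = ennreal (?J * exp (v * (y - v * h))) * (ennreal (exp (v\<^sup>2 * h / 2)) *
      ennreal ((1 - 16 * h / r\<^sup>2) * bump (y / r)))"
    by (simp add: ennreal_mult' mult.assoc)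
  also have "\<dots> \<le> ennreal (?J * exp (v * (y - v * h))) * (ennreal (exp (v\<^sup>2 * h / 2)) *
      (\<integral>\<^sup>+z. ennreal (bump ((y + z) / r)) \<partial>gauss h))"
    using h r by (intro mult_left_mono nn_integral_gauss_bump) auto
  also have "\<dots> = ennreal (?J * exp (v * (y - v * h))) *
      (\<integral>\<^sup>+z. ennreal (exp (v * z)) * ennreal (bump ((y + z - v * h) / r)) \<partial>gauss h)"
    using h by (subst nn_integral_gauss_tilt) (simp_all add: algebra_simps)
  also have "\<dots> = (\<integral>\<^sup>+z. ennreal (?J * exp (v * (y - v * h))) *
      (ennreal (exp (v * z)) * ennreal (bump ((y + z - v * h) / r))) \<partial>gauss h)"
    by (rule nn_integral_cmult[symmetric]) simp
  also have "\<dots> \<le> (\<integral>\<^sup>+z. ennreal (exp (v' * (y + z - v * h)) * bump ((y + z - v * h) / r)) \<partial>gauss h)"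
  proof (intro nn_integral_mono)
    fix z
    define q where "q = y + z - v * h"
    \<comment> \<open>On the support of the bump the two tilts differ by a factor of at most
      \<open>exp (r * \<bar>v' - v\<bar>)\<close>; off the support both sides vanish.\<close>
    have "?J * exp (v * q) * bump (q / r) \<le> exp (v' * q) * bump (q / r)"
    proof (cases "\<bar>q\<bar> < r")
      case True
      have "(v - v') * q \<le> \<bar>v' - v\<bar> * \<bar>q\<bar>"
        by (metis abs_ge_self abs_minus_commute abs_mult)
      also have "\<dots> \<le> \<bar>v' - v\<bar> * r" using True by (intro mult_left_mono) auto
      finally have "- (r * \<bar>v' - v\<bar>) + v * q \<le> v' * q" by (simp add: algebra_simps)
      then have "?J * exp (v * q) \<le> exp (v' * q)" by (simp add: exp_add[symmetric])
      then show ?thesis by (intro mult_right_mono bump_nonneg)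
    next
      case False
      then have "bump (q / r) = 0" using r by (intro bump_eq_0) (simp add: le_divide_eq)
      then show ?thesis by simp
    qed
    then have "ennreal (?J * exp (v * q) * bump (q / r)) \<le> ennreal (exp (v' * q) * bump (q / r))"
      by (rule ennreal_leI)
    also have "?J * exp (v * q) * bump (q / r)
        = ?J * exp (v * (y - v * h)) * (exp (v * z) * bump (q / r))"
    proof -
      have "v * q = v * (y - v * h) + v * z" by (simp add: q_def algebra_simps)
      then have "exp (v * q) = exp (v * (y - v * h)) * exp (v * z)" by (simp only: exp_add)
      then show ?thesis by (simp only: mult.assoc)
    qed
    finally show "ennreal (?J * exp (v * (y - v * h))) *
      (ennreal (exp (v * z)) * ennreal (bump ((y + z - v * h) / r)))
      \<le> ennreal (exp (v' * (y + z - v * h)) * bump ((y + z - v * h) / r))"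
      by (simp add: q_def ennreal_mult' bump_nonneg)
  qed
  finally show ?thesis .
qed

section \<open>Survival of a killed random walk\<close>

lemma (in prob_space) nn_integral_indep_var:
  assumes ind: "indep_var N Y L Z" and [measurable]: "F \<in> borel_measurable (N \<Otimes>\<^sub>M L)"
  shows "(\<integral>\<^sup>+\<omega>. F (Y \<omega>, Z \<omega>) \<partial>M) = (\<integral>\<^sup>+\<omega>. (\<integral>\<^sup>+z. F (Y \<omega>, z) \<partial>distr M L Z) \<partial>M)"
proof -
  have [measurable]: "Y \<in> measurable M N" "Z \<in> measurable M L"
    and eq: "distr M N Y \<Otimes>\<^sub>M distr M L Z = distr M (N \<Otimes>\<^sub>M L) (\<lambda>x. (Y x, Z x))"
    using ind by (simp_all add: indep_var_distribution_eq)
  interpret Z: prob_space "distr M L Z" by (rule prob_space_distr) simp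
  have [measurable]: "F \<in> borel_measurable (N \<Otimes>\<^sub>M distr M L Z)"
    by (rule measurable_cong_sets[THEN equalityD1, THEN subsetD, rotated 2, of _ "N \<Otimes>\<^sub>M L"])
       (auto intro!: sets_pair_measure_cong)
  have "(\<integral>\<^sup>+\<omega>. F (Y \<omega>, Z \<omega>) \<partial>M) = (\<integral>\<^sup>+p. F p \<partial>(distr M N Y \<Otimes>\<^sub>M distr M L Z))"
    unfolding eq by (subst nn_integral_distr) simp_all
  also have "\<dots> = (\<integral>\<^sup>+y. (\<integral>\<^sup>+z. F (y, z) \<partial>distr M L Z) \<partial>distr M N Y)"
    by (rule Z.nn_integral_fst[symmetric]) simp
  also have "\<dots> = (\<integral>\<^sup>+\<omega>. (\<integral>\<^sup>+z. F (Y \<omega>, z) \<partial>distr M L Z) \<partial>M)"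
    by (rule nn_integral_distr) measurable
  finally show ?thesis .
qed

text \<open>The expectation of \<open>U i\<close> at the walk's position, restricted to survival up
  to time \<open>i\<close>, does not decrease with \<open>i\<close>: a step can only raise it, and
  killing loses nothing because \<open>U\<close> vanishes outside \<open>A\<close>. At time
  \<open>n\<close> it is at most the survival probability.\<close>

lemma (in prob_space) walk_survival_ge_subsolution:
  fixes \<xi> :: "nat \<Rightarrow> 'a \<Rightarrow> real" and U :: "nat \<Rightarrow> real \<Rightarrow> ennreal"
  assumes ind: "indep_vars (\<lambda>_. borel) \<xi> {..<n}"
    and A [measurable]: "\<And>i. A i \<in> sets borel"
    and U [measurable]: "\<And>i. U i \<in> borel_measurable borel"
    and out: "\<And>i y. i \<le> n \<Longrightarrow> y \<notin> A i \<Longrightarrow> U i y = 0"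
    and last: "\<And>y. U n y \<le> 1"
    and step: "\<And>i y. i < n \<Longrightarrow> U i y \<le> (\<integral>\<^sup>+z. U (Suc i) (y + z) \<partial>distr M borel (\<xi> i))"
  shows "U 0 0 \<le> emeasure M {\<omega> \<in> space M. \<forall>i\<le>n. (\<Sum>j<i. \<xi> j \<omega>) \<in> A i}"
proof -
  have \<xi> [measurable]: "\<xi> i \<in> borel_measurable M" if "i < n" for i
    using ind that by (auto simp: indep_vars_def)
  define S where "S i \<omega> = (\<Sum>j<i. \<xi> j \<omega>)" for i \<omega>
  have S [measurable]: "S i \<in> borel_measurable M" if "i \<le> n" for i
    unfolding S_def using that by (intro borel_measurable_sum \<xi>) auto
  define E where "E i = {\<omega> \<in> space M. \<forall>k\<in>{..i}. S k \<omega> \<in> A k}" for i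
  have E_sets [measurable]: "E i \<in> sets M" if "i \<le> n" for i
    unfolding E_def
  proof (intro sets.sets_Collect_finite_All')
    fix k assume "k \<in> {..i}"
    then show "{\<omega> \<in> space M. S k \<omega> \<in> A k} \<in> sets M"
      using that measurable_sets[OF S A, of k k] by (simp add: vimage_def Int_def conj_commute)
  qed auto
  have main: "i \<le> n \<Longrightarrow> U 0 0 \<le> (\<integral>\<^sup>+\<omega>. indicator (E i) \<omega> * U i (S i \<omega>) \<partial>M)" for i
  proof (induction i)
    case 0
    have "U 0 0 = (\<integral>\<^sup>+\<omega>. U 0 0 \<partial>M)" by (simp add: emeasure_space_1)
    also have "\<dots> \<le> (\<integral>\<^sup>+\<omega>. indicator (E 0) \<omega> * U 0 (S 0 \<omega>) \<partial>M)"
      using out[of 0 0] by (intro nn_integral_mono) (auto simp: E_def S_def indicator_def)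
    finally show ?case .
  next
    case (Suc i)
    let ?P = "PiM {..<i} (\<lambda>_. borel :: real measure)"
    \<comment> \<open>\<open>R\<close> collects the past increments as one random element. Survival
      up to \<open>i\<close> is the event that \<open>R\<close> lies in \<open>G\<close>, hence
      independent of the next increment \<open>Z\<close>.\<close>
    define R where "R \<omega> = restrict (\<lambda>j. \<xi> j \<omega>) {..<i}" for \<omega>
    define s where "s k f = (\<Sum>j<k. f j)" for k and f :: "nat \<Rightarrow> real"
    have s [measurable]: "s k \<in> borel_measurable ?P" if "k \<le> i" for k
      unfolding s_def using that by (intro borel_measurable_sum measurable_component_singleton) auto
    define G where "G = {f \<in> space ?P. \<forall>k\<in>{..i}. s k f \<in> A k}"
    have [measurable]: "G \<in> sets ?P"
      unfolding G_def
    proof (intro sets.sets_Collect_finite_All')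
      fix k assume "k \<in> {..i}"
      then show "{f \<in> space ?P. s k f \<in> A k} \<in> sets ?P"
        using measurable_sets[OF s A, of k k] by (simp add: vimage_def Int_def conj_commute)
    qed auto
    have sR: "s k (R \<omega>) = S k \<omega>" if "k \<le> i" for k \<omega>
      unfolding s_def R_def S_def using that by (intro sum.cong) auto
    have G: "indicator G (R \<omega>) = (indicator (E i) \<omega> :: ennreal)" if "\<omega> \<in> space M" for \<omega>
    proof -
      have "R \<omega> \<in> space ?P" by (auto simp: R_def space_PiM)
      then have "R \<omega> \<in> G \<longleftrightarrow> \<omega> \<in> E i" using that by (auto simp: G_def E_def sR)
      then show ?thesis by (auto simp: indicator_def)
    qed
    let ?L = "PiM {i} (\<lambda>_. borel :: real measure)"
    define Z where "Z \<omega> = restrict (\<lambda>j. \<xi> j \<omega>) {i}" for \<omega>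
    have ind': "indep_var ?P R ?L Z"
      unfolding R_def Z_def using Suc.prems by (intro indep_var_restrict[OF ind]) auto
    have [measurable]: "Z \<in> measurable M ?L" using ind' by (rule indep_var_rv2)
    have [measurable]: "\<xi> i \<in> borel_measurable M" using Suc.prems by (intro \<xi>) simp
    have Z: "(\<integral>\<^sup>+z. H z \<partial>distr M borel (\<xi> i)) = (\<integral>\<^sup>+g. H (g i) \<partial>distr M ?L Z)"
      if [measurable]: "H \<in> borel_measurable borel" for H
      by (simp add: nn_integral_distr Z_def)
    have "U 0 0 \<le> (\<integral>\<^sup>+\<omega>. indicator (E i) \<omega> * U i (S i \<omega>) \<partial>M)"
      using Suc by simp
    also have "\<dots> \<le> (\<integral>\<^sup>+\<omega>. indicator (E i) \<omega> * (\<integral>\<^sup>+z. U (Suc i) (S i \<omega> + z) \<partial>distr M borel (\<xi> i)) \<partial>M)"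
      using Suc.prems by (intro nn_integral_mono mult_left_mono step) auto
    also have "\<dots> = (\<integral>\<^sup>+\<omega>. (\<integral>\<^sup>+g. indicator G (R \<omega>) * U (Suc i) (s i (R \<omega>) + g i) \<partial>distr M ?L Z) \<partial>M)"
      by (intro nn_integral_cong) (simp add: G sR nn_integral_cmult Z)
    also have "\<dots> = (\<integral>\<^sup>+\<omega>. indicator G (R \<omega>) * U (Suc i) (s i (R \<omega>) + Z \<omega> i) \<partial>M)"
      using nn_integral_indep_var[OF ind', of "\<lambda>(f, g). indicator G f * U (Suc i) (s i f + g i)"]
      by simp
    also have "\<dots> = (\<integral>\<^sup>+\<omega>. indicator (E i) \<omega> * U (Suc i) (S (Suc i) \<omega>) \<partial>M)"
      by (intro nn_integral_cong) (simp add: G sR, simp add: S_def Z_def)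
    \<comment> \<open>Shrinking the event is free: on the removed part \<open>U (Suc i)\<close> is
      zero.\<close>
    also have "\<dots> \<le> (\<integral>\<^sup>+\<omega>. indicator (E (Suc i)) \<omega> * U (Suc i) (S (Suc i) \<omega>) \<partial>M)"
      using out[OF Suc.prems]
      by (intro nn_integral_mono) (auto simp: E_def indicator_def le_Suc_eq)
    finally show ?case .
  qed
  have "U 0 0 \<le> (\<integral>\<^sup>+\<omega>. indicator (E n) \<omega> * U n (S n \<omega>) \<partial>M)" by (rule main) simp
  also have "\<dots> \<le> (\<integral>\<^sup>+\<omega>. indicator (E n) \<omega> \<partial>M)"
    using last by (intro nn_integral_mono) (auto simp: indicator_def)
  also have "\<dots> = emeasure M (E n)" by simp
  also have "E n = {\<omega> \<in> space M. \<forall>i\<le>n. (\<Sum>j<i. \<xi> j \<omega>) \<in> A i}"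
    unfolding E_def S_def by auto
  finally show ?thesis .
qed

section \<open>Brownian motion on a grid\<close>

lemma std_BM_prob_space: "std_BM M X \<Longrightarrow> prob_space M"
  and std_BM_measurable: "std_BM M X \<Longrightarrow> X t \<in> borel_measurable M"
  and std_BM_0: "std_BM M X \<Longrightarrow> \<omega> \<in> space M \<Longrightarrow> X 0 \<omega> = 0"
  and std_BM_continuous: "std_BM M X \<Longrightarrow> \<omega> \<in> space M \<Longrightarrow> continuous_on {0..} (\<lambda>t. X t \<omega>)"
  by (auto simp: std_BM_def)

lemma std_BM_distr_increment:
  assumes "std_BM M X" "0 \<le> s" "s < t"
  shows "distr M borel (\<lambda>\<omega>. X t \<omega> - X s \<omega>) = gauss (t - s)"
proof -
  have "distributed M lborel (\<lambda>\<omega>. X t \<omega> - X s \<omega>) (normal_density 0 (sqrt (t - s)))"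
    using assms by (auto simp: std_BM_def)
  then have "distr M lborel (\<lambda>\<omega>. X t \<omega> - X s \<omega>) = gauss (t - s)"
    unfolding gauss_def by (rule distributed_distr_eq_density)
  moreover have "distr M lborel (\<lambda>\<omega>. X t \<omega> - X s \<omega>) = distr M borel (\<lambda>\<omega>. X t \<omega> - X s \<omega>)"
    by (rule distr_cong) auto
  ultimately show ?thesis by simp
qed

lemma std_BM_indep_increments:
  assumes X: "std_BM M X" and s: "0 \<le> s" and h: "0 < h"
  shows "prob_space.indep_vars M (\<lambda>_. borel)
    (\<lambda>i \<omega>. X (s + real (Suc i) * h) \<omega> - X (s + real i * h) \<omega>) {..<n}"
proof -
  interpret prob_space M using X by (rule std_BM_prob_space)
  define ts where "ts = map (\<lambda>i. s + real i * h) [0..<Suc n]"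
  have "sorted ts" "distinct ts" "\<forall>u\<in>set ts. 0 \<le> u"
    using s h by (auto simp: ts_def sorted_iff_nth_mono distinct_map inj_on_def
        simp del: upt_Suc intro!: mult_right_mono)
  then have "indep_vars (\<lambda>_. borel) (\<lambda>i \<omega>. X (ts ! Suc i) \<omega> - X (ts ! i) \<omega>) {..<length ts - 1}"
    using X by (auto simp: std_BM_def)
  then have "indep_vars (\<lambda>_. borel) (\<lambda>i \<omega>. X (ts ! Suc i) \<omega> - X (ts ! i) \<omega>) {..<n}"
    by (simp add: ts_def del: upt_Suc)
  then show ?thesis
    by (rule indep_vars_cong[THEN iffD1, rotated -1])
       (auto simp: ts_def fun_eq_iff simp del: upt_Suc)
qed

text \<open>Grid increments are independent with law \<open>gauss h\<close> and telescope to the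
  path. The starting time \<open>s\<close> is left free so that the estimate can be used on any
  block.\<close>

lemma std_BM_grid_survival_ge_subsolution:
  assumes X: "std_BM M X" and s: "0 \<le> s" and h: "0 < h"
    and A: "\<And>i. A i \<in> sets borel"
    and U: "\<And>i. U i \<in> borel_measurable borel"
    and out: "\<And>i y. i \<le> n \<Longrightarrow> y \<notin> A i \<Longrightarrow> U i y = 0"
    and last: "\<And>y. U n y \<le> 1"
    and step: "\<And>i y. i < n \<Longrightarrow> U i y \<le> (\<integral>\<^sup>+z. U (Suc i) (y + z) \<partial>gauss h)"
  shows "U 0 0 \<le> emeasure M {\<omega> \<in> space M. \<forall>i\<le>n. X (s + real i * h) \<omega> - X s \<omega> \<in> A i}"
proof -
  interpret prob_space M using X by (rule std_BM_prob_space)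
  define \<xi> where "\<xi> i \<omega> = X (s + real (Suc i) * h) \<omega> - X (s + real i * h) \<omega>" for i \<omega>
  have sum: "(\<Sum>j<i. \<xi> j \<omega>) = X (s + real i * h) \<omega> - X s \<omega>" for i \<omega>
    unfolding \<xi>_def sum_lessThan_telescope[of "\<lambda>i. X (s + real i * h) \<omega>"] by simp
  have "distr M borel (\<xi> i) = gauss ((s + real (Suc i) * h) - (s + real i * h))" for i
    unfolding \<xi>_def using s h by (intro std_BM_distr_increment[OF X]) (auto simp: algebra_simps)
  then have d: "distr M borel (\<xi> i) = gauss h" for i by (simp add: algebra_simps)
  have "indep_vars (\<lambda>_. borel) \<xi> {..<n}"
    unfolding \<xi>_def by (rule std_BM_indep_increments[OF X s h])
  then have "U 0 0 \<le> emeasure M {\<omega> \<in> space M. \<forall>i\<le>n. (\<Sum>j<i. \<xi> j \<omega>) \<in> A i}"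
    by (rule walk_survival_ge_subsolution) (use A U out last step in \<open>auto simp: d\<close>)
  then show ?thesis unfolding sum .
qed

text \<open>Discrete Girsanov estimate. The subsolution is an exponential tilt of the bump around the
  moving centre \<open>c\<close>; changing the tilt from \<open>v i\<close> to \<open>v (Suc i)\<close> inside a tube of radius \<open>r\<close> costs
  \<open>r * \<bar>v (Suc i) - v i\<bar>\<close>.\<close>

lemma std_BM_grid_moving_tube:
  fixes v c :: "nat \<Rightarrow> real"
  assumes X: "std_BM M X" and h: "0 < h" and r: "0 < r" and hr: "32 * h \<le> r\<^sup>2"
    and vn: "v n = 0" and c0: "c 0 = 0" and c: "\<And>i. i < n \<Longrightarrow> c (Suc i) = c i + v i * h"
  shows "ennreal (exp (- (\<Sum>i<n. (v i)\<^sup>2 * h / 2 + 32 * h / r\<^sup>2 + r * \<bar>v (Suc i) - v i\<bar>)))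
    \<le> emeasure M {\<omega> \<in> space M. \<forall>i\<le>n. \<bar>X (real i * h) \<omega> - c i\<bar> \<le> r}"
proof -
  define K where "K i = (v i)\<^sup>2 * h / 2 + 32 * h / r\<^sup>2 + r * \<bar>v (Suc i) - v i\<bar>" for i
  define V where "V i y = exp (v i * (y - c i)) * bump ((y - c i) / r)" for i y
  \<comment> \<open>The prefactor pays for the steps still to come. At time \<open>n\<close> nothing
    is left to pay and \<open>v n = 0\<close> removes the tilt, which gives
    \<open>U n y \<le> 1\<close>.\<close>
  define U where "U i y = ennreal (exp (- (\<Sum>j\<in>{i..<n}. K j)) * V i y)" for i y
  have [measurable]: "V i \<in> borel_measurable borel" for i
    unfolding V_def[abs_def] by measurable
  have "U 0 0 \<le> emeasure M {\<omega> \<in> space M. \<forall>i\<le>n. X (0 + real i * h) \<omega> - X 0 \<omega> \<in> {y. \<bar>y - c i\<bar> \<le> r}}"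
  proof (rule std_BM_grid_survival_ge_subsolution[OF X order_refl h])
    show "{y. \<bar>y - c i\<bar> \<le> r} \<in> sets borel" for i by measurable
    show "U i \<in> borel_measurable borel" for i unfolding U_def[abs_def] by measurable
    show "U i y = 0" if "y \<notin> {y. \<bar>y - c i\<bar> \<le> r}" for i y
    proof -
      have "bump ((y - c i) / r) = 0" using that r by (intro bump_eq_0) (simp add: le_divide_eq)
      then show ?thesis by (simp add: U_def V_def)
    qed
    show "U n y \<le> 1" for y by (simp add: U_def V_def vn bump_le_1)
    show "U i y \<le> (\<integral>\<^sup>+z. U (Suc i) (y + z) \<partial>gauss h)" if "i < n" for i y
    proof -
      have split: "(\<Sum>j\<in>{i..<n}. K j) = (\<Sum>j\<in>{Suc i..<n}. K j) + K i"
        using sum.atLeast_Suc_lessThan[OF that, of K] by simp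
      let ?C = "exp (- (\<Sum>j\<in>{Suc i..<n}. K j))"
      \<comment> \<open>The recursion for \<open>c\<close> makes the centre move exactly by the
        drift that the tilt produces.\<close>
      have shift: "y - c i + z - v i * h = y + z - c (Suc i)" for z using c[OF that] by simp
      have "U i y = ennreal ?C * ennreal (exp (- K i) * V i y)"
        unfolding U_def split by (simp add: exp_add[symmetric] ennreal_mult'[symmetric] mult.assoc[symmetric])
      also have "\<dots> \<le> ennreal ?C * (\<integral>\<^sup>+z. ennreal (V (Suc i) (y + z)) \<partial>gauss h)"
        using nn_integral_gauss_tilted_bump[OF h r hr, of "v i" "v (Suc i)" "y - c i"]
        unfolding shift V_def K_def by (intro mult_left_mono) auto
      also have "\<dots> = (\<integral>\<^sup>+z. ennreal ?C * ennreal (V (Suc i) (y + z)) \<partial>gauss h)"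
        by (rule nn_integral_cmult[symmetric]) simp
      also have "\<dots> = (\<integral>\<^sup>+z. U (Suc i) (y + z) \<partial>gauss h)"
        by (simp add: U_def ennreal_mult')
      finally show ?thesis .
    qed
  qed
  also have "{\<omega> \<in> space M. \<forall>i\<le>n. X (0 + real i * h) \<omega> - X 0 \<omega> \<in> {y. \<bar>y - c i\<bar> \<le> r}}
      = {\<omega> \<in> space M. \<forall>i\<le>n. \<bar>X (real i * h) \<omega> - c i\<bar> \<le> r}"
    using std_BM_0[OF X] by auto
  also have "U 0 0 = ennreal (exp (- (\<Sum>i<n. K i)))"
    by (simp add: U_def V_def c0 bump_0 atLeast0LessThan)
  finally show ?thesis unfolding K_def .
qed

section \<open>Exponential moments and a maximal inequality on grids\<close>

lemma nn_integral_gauss_exp: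
  assumes "0 < h"
  shows "(\<integral>\<^sup>+z. ennreal (exp (v * z)) \<partial>gauss h) = ennreal (exp (v\<^sup>2 * h / 2))"
proof -
  interpret prob_space "gauss h" using assms by (rule prob_space_gauss)
  show ?thesis
    using nn_integral_gauss_tilt[of "\<lambda>_. 1" h v] assms emeasure_space_1 by simp
qed

text \<open>\<open>cosh\<close> is an eigenfunction of the Gaussian step. It serves as a two-sided
  exponential martingale.\<close>

lemma nn_integral_gauss_cosh:
  assumes h: "0 < h"
  shows "(\<integral>\<^sup>+z. ennreal (cosh (v * (y + z))) \<partial>gauss h) = ennreal (exp (v\<^sup>2 * h / 2) * cosh (v * y))"
proof -
  have e: "cosh (v * (y + z)) = exp (v * y) / 2 * exp (v * z) + exp (- (v * y)) / 2 * exp (- v * z)" for z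
    by (simp add: cosh_field_def exp_add[symmetric] algebra_simps add_divide_distrib)
  have "(\<integral>\<^sup>+z. ennreal (cosh (v * (y + z))) \<partial>gauss h)
    = (\<integral>\<^sup>+z. ennreal (exp (v * y) / 2) * ennreal (exp (v * z))
        + ennreal (exp (- (v * y)) / 2) * ennreal (exp (- v * z)) \<partial>gauss h)"
    unfolding e by (intro nn_integral_cong) (simp only: ennreal_plus ennreal_mult exp_ge_zero
        divide_nonneg_nonneg mult_nonneg_nonneg zero_le_numeral)
  also have "\<dots> = ennreal (exp (v * y) / 2) * ennreal (exp (v\<^sup>2 * h / 2))
        + ennreal (exp (- (v * y)) / 2) * ennreal (exp ((- v)\<^sup>2 * h / 2))"
    using nn_integral_gauss_exp[OF h, of v] nn_integral_gauss_exp[OF h, of "- v"]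
    by (simp add: nn_integral_add nn_integral_cmult)
  also have "\<dots> = ennreal (exp (v * y) / 2 * exp (v\<^sup>2 * h / 2) + exp (- (v * y)) / 2 * exp (v\<^sup>2 * h / 2))"
    by (simp flip: ennreal_plus ennreal_mult)
  also have "\<dots> = ennreal (exp (v\<^sup>2 * h / 2) * cosh (v * y))"
    by (simp add: cosh_field_def algebra_simps add_divide_distrib)
  finally show ?thesis .
qed

text \<open>A martingale \<open>g\<close> that is at least 1 outside the interval, truncated at 1,
  is a supersolution; its complement is a subsolution for survival. The bound sees the grid only
  through its total length \<open>n * h\<close>.\<close>

lemma std_BM_grid_maximal:
  assumes X: "std_BM M X" and s: "0 \<le> s" and h: "0 < h" and \<epsilon>: "0 < \<epsilon>" and n: "0 < n"
  shows "ennreal (1 - 2 * exp (- \<epsilon>\<^sup>2 / (2 * (real n * h))))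
    \<le> emeasure M {\<omega> \<in> space M. \<forall>i\<le>n. \<bar>X (s + real i * h) \<omega> - X s \<omega>\<bar> \<le> \<epsilon>}"
proof -
  interpret G: prob_space "gauss h" using h by (rule prob_space_gauss)
  \<comment> \<open>Minimises \<open>\<theta>\<^sup>2 * n * h / 2 - \<theta> * \<epsilon>\<close>,
    the exponent in the bound for \<open>g 0 0\<close>.\<close>
  define \<theta> where "\<theta> = \<epsilon> / (real n * h)"
  have \<theta>: "0 < \<theta>" using \<epsilon> n h by (simp add: \<theta>_def)
  \<comment> \<open>The exponential compensates the growth of \<open>cosh\<close> over the remaining
    steps, and the denominator brings \<open>g\<close> up to 1 at distance \<open>\<epsilon>\<close>
    from 0.\<close>
  define k where "k i = exp (\<theta>\<^sup>2 * h / 2 * (real n - real i)) / cosh (\<theta> * \<epsilon>)" for i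
  define g where "g i y = k i * cosh (\<theta> * y)" for i y
  have k_nonneg: "0 \<le> k i" for i by (simp add: k_def cosh_real_nonneg)
  then have g_nonneg: "0 \<le> g i y" for i y by (simp add: g_def cosh_real_nonneg)
  have [measurable]: "(cosh :: real \<Rightarrow> real) \<in> borel_measurable borel"
    by (intro borel_measurable_continuous_onI continuous_intros)
  have [measurable]: "g i \<in> borel_measurable borel" for i
    unfolding g_def[abs_def] by measurable
  define U where "U i y = ennreal (1 - min 1 (g i y))" for i y
  have "U 0 0 \<le> emeasure M {\<omega> \<in> space M. \<forall>i\<le>n. X (s + real i * h) \<omega> - X s \<omega> \<in> {y. \<bar>y\<bar> \<le> \<epsilon>}}"
  proof (rule std_BM_grid_survival_ge_subsolution[OF X s h])
    show "{y. \<bar>y\<bar> \<le> \<epsilon>} \<in> sets borel" by measurable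
    show "U i \<in> borel_measurable borel" for i unfolding U_def[abs_def] by measurable
    show "U i y = 0" if "i \<le> n" "y \<notin> {y. \<bar>y\<bar> \<le> \<epsilon>}" for i y
    proof -
      have "cosh (\<theta> * \<epsilon>) \<le> cosh (\<theta> * \<bar>y\<bar>)"
        using that(2) \<theta> \<epsilon> by (subst cosh_real_nonneg_le_iff) auto
      also have "\<dots> = cosh (\<theta> * y)" by (cases "0 \<le> y") auto
      finally have "cosh (\<theta> * \<epsilon>) \<le> cosh (\<theta> * y)" .
      then have "1 \<le> cosh (\<theta> * y) / cosh (\<theta> * \<epsilon>)" by simp
      then have "1 * 1 \<le> exp (\<theta>\<^sup>2 * h / 2 * (real n - real i)) * (cosh (\<theta> * y) / cosh (\<theta> * \<epsilon>))"
        using that(1) h by (intro mult_mono) auto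
      then have "1 \<le> g i y" by (simp add: g_def k_def)
      then show ?thesis by (simp add: U_def)
    qed
    show "U n y \<le> 1" for y using g_nonneg[of n y] by (simp add: U_def)
    show "U i y \<le> (\<integral>\<^sup>+z. U (Suc i) (y + z) \<partial>gauss h)" if "i < n" for i y
    proof -
      define I where "I = (\<integral>\<^sup>+z. U (Suc i) (y + z) \<partial>gauss h)"
      have "(\<integral>\<^sup>+z. ennreal (g (Suc i) (y + z)) \<partial>gauss h)
          = ennreal (k (Suc i)) * (\<integral>\<^sup>+z. ennreal (cosh (\<theta> * (y + z))) \<partial>gauss h)"
        unfolding g_def using k_nonneg
        by (subst nn_integral_cmult[symmetric]) (auto simp: ennreal_mult')
      also have "\<dots> = ennreal (k (Suc i) * exp (\<theta>\<^sup>2 * h / 2) * cosh (\<theta> * y))"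
        unfolding nn_integral_gauss_cosh[OF h] using k_nonneg
        by (simp add: ennreal_mult'[symmetric] mult.assoc)
      also have "k (Suc i) * exp (\<theta>\<^sup>2 * h / 2) = k i"
        by (simp add: k_def exp_add[symmetric] algebra_simps add_divide_distrib diff_divide_distrib)
      also have "k i * cosh (\<theta> * y) = g i y" by (simp add: g_def)
      finally have gi: "(\<integral>\<^sup>+z. ennreal (g (Suc i) (y + z)) \<partial>gauss h) = ennreal (g i y)" .
      have "ennreal (min 1 (g (Suc i) (y + z))) \<le> 1" for z
        by (metis ennreal_1 ennreal_leI min.cobounded1)
      then have "(\<integral>\<^sup>+z. ennreal (min 1 (g (Suc i) (y + z))) \<partial>gauss h) \<le> (\<integral>\<^sup>+z. 1 \<partial>gauss h)"
        by (intro nn_integral_mono)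
      then have le1: "(\<integral>\<^sup>+z. ennreal (min 1 (g (Suc i) (y + z))) \<partial>gauss h) \<le> 1"
        using G.emeasure_space_1 by simp
      have le2: "(\<integral>\<^sup>+z. ennreal (min 1 (g (Suc i) (y + z))) \<partial>gauss h) \<le> ennreal (g i y)"
        unfolding gi[symmetric] by (intro nn_integral_mono ennreal_leI) auto
      have le: "(\<integral>\<^sup>+z. ennreal (min 1 (g (Suc i) (y + z))) \<partial>gauss h) \<le> ennreal (min 1 (g i y))"
        using le1 le2 by (simp add: min_def)
      \<comment> \<open>\<open>U\<close> and the truncated \<open>g\<close> add up to 1, so the
        upper bound for one integral becomes a lower bound for the other.\<close>
      have "1 = (\<integral>\<^sup>+z. 1 \<partial>gauss h)" using G.emeasure_space_1 by simp
      also have "\<dots> = (\<integral>\<^sup>+z. U (Suc i) (y + z) + ennreal (min 1 (g (Suc i) (y + z))) \<partial>gauss h)"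
        unfolding U_def using g_nonneg by (intro nn_integral_cong) (simp flip: ennreal_plus)
      also have "\<dots> = I + (\<integral>\<^sup>+z. ennreal (min 1 (g (Suc i) (y + z))) \<partial>gauss h)"
        unfolding I_def U_def by (rule nn_integral_add) measurable
      also have "\<dots> \<le> I + ennreal (min 1 (g i y))" by (rule add_left_mono[OF le])
      finally have "1 - ennreal (min 1 (g i y)) \<le> I" by (simp add: ennreal_minus_le_iff add.commute)
      moreover have "U i y = 1 - ennreal (min 1 (g i y))"
        unfolding U_def using g_nonneg[of i y] by (simp add: ennreal_minus flip: ennreal_1)
      ultimately show ?thesis by (simp add: I_def)
    qed
  qed
  moreover have "1 - 2 * exp (- \<epsilon>\<^sup>2 / (2 * (real n * h))) \<le> 1 - min 1 (g 0 0)"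
  proof -
    define L where "L = \<epsilon>\<^sup>2 / (2 * (real n * h))"
    have "\<theta>\<^sup>2 * h / 2 * real n = L" "\<theta> * \<epsilon> = 2 * L"
      using n h by (simp_all add: \<theta>_def L_def field_simps power2_eq_square)
    then have "g 0 0 = exp L / cosh (2 * L)"
      by (simp add: g_def k_def)
    also have "\<dots> \<le> exp L / (exp (2 * L) / 2)"
      by (intro divide_left_mono) (auto simp: cosh_field_def intro!: mult_pos_pos add_pos_pos divide_pos_pos)
    also have "\<dots> = 2 * exp (- L)"
      by (subst exp_double) (simp add: exp_minus power2_eq_square field_simps)
    also have "- L = - \<epsilon>\<^sup>2 / (2 * (real n * h))" by (simp add: L_def)
    finally show ?thesis by simp
  qed
  then have "ennreal (1 - 2 * exp (- \<epsilon>\<^sup>2 / (2 * (real n * h)))) \<le> U 0 0"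
    unfolding U_def by (rule ennreal_leI)
  ultimately show ?thesis by simp
qed

section \<open>From grids to paths\<close>

text \<open>The grid points just to the left of \<open>s\<close> converge to \<open>s\<close>, and
  continuity carries the sign over.\<close>

lemma nonneg_on_interval_if_dyadic:
  fixes f :: "real \<Rightarrow> real"
  assumes f: "continuous_on {0..t} f" and t: "0 < t" and n: "0 < n"
    and grid: "\<And>m i. i \<le> n * 2 ^ m \<Longrightarrow> 0 \<le> f (real i * (t / real (n * 2 ^ m)))"
    and s: "s \<in> {0..t}"
  shows "0 \<le> f s"
proof -
  define h where "h m = t / real (n * 2 ^ m)" for m :: nat
  define i where "i m = nat \<lfloor>s / h m\<rfloor>" for m
  have h_pos: "0 < h m" for m using t n by (simp add: h_def)
  have h_lim: "h \<longlonglongrightarrow> 0"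
  proof -
    have "(\<lambda>m. t / real n * (1 / 2) ^ m) \<longlonglongrightarrow> t / real n * 0"
      by (intro tendsto_intros LIMSEQ_power_zero) auto
    then show ?thesis by (simp add: h_def[abs_def] power_one_over field_simps)
  qed
  have fl: "real (i m) \<le> s / h m" "s / h m \<le> real (i m) + 1" for m
    using s h_pos[of m] by (auto simp: i_def)
  have lo: "real (i m) * h m \<le> s" and up: "s - h m \<le> real (i m) * h m" for m
    using fl[of m] h_pos[of m] by (simp_all add: field_simps)
  have "(\<lambda>m. real (i m) * h m) \<longlonglongrightarrow> s"
  proof (rule tendsto_sandwich)
    show "(\<lambda>m. s - h m) \<longlonglongrightarrow> s" using tendsto_diff[OF tendsto_const h_lim, of s] by simp
  qed (use lo up in auto)
  moreover have in_t: "real (i m) * h m \<in> {0..t}" for m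
    using lo[of m] s h_pos[of m] by auto
  ultimately have lim: "(\<lambda>m. f (real (i m) * h m)) \<longlonglongrightarrow> f s"
    using s by (intro continuous_on_tendsto_compose[OF f]) auto
  have "i m \<le> n * 2 ^ m" for m
  proof -
    have "s / h m \<le> t / h m" using s h_pos[of m] by (intro divide_right_mono) auto
    also have "t / h m = real (n * 2 ^ m)" using t n by (simp add: h_def)
    finally have "real (i m) \<le> real (n * 2 ^ m)" using fl(1)[of m] by linarith
    then show ?thesis by (simp only: of_nat_le_iff)
  qed
  then have "0 \<le> f (real (i m) * h m)" for m unfolding h_def by (rule grid)
  then show ?thesis by (intro LIMSEQ_le_const[OF lim]) auto
qed

text \<open>Nested grids make the path event a decreasing intersection of grid events, so a lower
  bound uniform in the grid survives by continuity from above. \<open>Q\<close> carries an extra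
  condition, such as one on the endpoint.\<close>

lemma (in prob_space) prob_nonneg_path:
  fixes F :: "real \<Rightarrow> 'a \<Rightarrow> real"
  assumes F [measurable]: "\<And>s. F s \<in> borel_measurable M"
    and cont: "\<And>\<omega>. \<omega> \<in> space M \<Longrightarrow> continuous_on {0..t} (\<lambda>s. F s \<omega>)"
    and Q [measurable]: "Q \<in> sets M" and t: "0 < t" and n: "0 < n"
  shows "{\<omega> \<in> space M. (\<forall>s\<in>{0..t}. 0 \<le> F s \<omega>) \<and> \<omega> \<in> Q} \<in> sets M" (is "?E \<in> _")
    and "(\<And>m. p \<le> prob {\<omega> \<in> space M. (\<forall>i\<le>n * 2 ^ m. 0 \<le> F (real i * (t / real (n * 2 ^ m))) \<omega>) \<and> \<omega> \<in> Q})
      \<Longrightarrow> p \<le> prob {\<omega> \<in> space M. (\<forall>s\<in>{0..t}. 0 \<le> F s \<omega>) \<and> \<omega> \<in> Q}"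
proof -
  define G where "G m = {\<omega> \<in> space M. (\<forall>i\<le>n * 2 ^ m. 0 \<le> F (real i * (t / real (n * 2 ^ m))) \<omega>) \<and> \<omega> \<in> Q}" for m
  have G [measurable]: "G m \<in> sets M" for m unfolding G_def by measurable
  have E: "?E = (\<Inter>m. G m)"
  proof (intro equalityI subsetI)
    fix \<omega> assume \<omega>: "\<omega> \<in> ?E"
    have "real i * (t / real (n * 2 ^ m)) \<in> {0..t}" if "i \<le> n * 2 ^ m" for i m
    proof -
      have "real i \<le> real (n * 2 ^ m)" using that by (simp only: of_nat_le_iff)
      then show ?thesis using t n by (simp add: field_simps)
    qed
    then show "\<omega> \<in> (\<Inter>m. G m)" using \<omega> by (simp add: G_def)
  next
    fix \<omega> assume \<omega>: "\<omega> \<in> (\<Inter>m. G m)"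
    then have sp: "\<omega> \<in> space M" "\<omega> \<in> Q" by (auto simp: G_def)
    have grid: "0 \<le> F (real i * (t / real (n * 2 ^ m))) \<omega>" if "i \<le> n * 2 ^ m" for m i
      using \<omega> that unfolding G_def by blast
    have "0 \<le> F s \<omega>" if "s \<in> {0..t}" for s
      by (rule nonneg_on_interval_if_dyadic[OF cont[OF sp(1)] t n grid that])
    then show "\<omega> \<in> ?E" using sp by auto
  qed
  have dec: "decseq G"
  proof (rule decseq_SucI, rule subsetI)
    fix m \<omega> assume \<omega>: "\<omega> \<in> G (Suc m)"
    have "0 \<le> F (real i * (t / real (n * 2 ^ m))) \<omega>" if "i \<le> n * 2 ^ m" for i
    proof -
      have "2 * i \<le> n * 2 ^ Suc m" using that by simp
      then have "0 \<le> F (real (2 * i) * (t / real (n * 2 ^ Suc m))) \<omega>"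
        using \<omega> unfolding G_def by blast
      then show ?thesis by simp
    qed
    then show "\<omega> \<in> G m" using \<omega> by (simp add: G_def)
  qed
  show "?E \<in> sets M" unfolding E by measurable
  have lim: "(\<lambda>m. prob (G m)) \<longlonglongrightarrow> prob ?E"
    unfolding E using dec by (intro finite_Lim_measure_decseq) auto
  show "p \<le> prob ?E" if "\<And>m. p \<le> prob {\<omega> \<in> space M. (\<forall>i\<le>n * 2 ^ m. 0 \<le> F (real i * (t / real (n * 2 ^ m))) \<omega>) \<and> \<omega> \<in> Q}"
    using that by (intro LIMSEQ_le_const[OF lim]) (auto simp: G_def)
qed

section \<open>Polygonal tubes and the lower bound for a fixed path of \<open>W\<close>\<close>

lemma sum_lessThan_blocks:
  fixes f :: "nat \<Rightarrow> 'a :: comm_monoid_add"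
  shows "(\<Sum>i<n * k. f i) = (\<Sum>m<n. \<Sum>l<k. f (m * k + l))"
proof -
  have "sum f {m * k..<m * k + k} = (\<Sum>l<k. f (m * k + l))" for m
    by (subst sum.atLeastLessThan_shift_0) (simp add: atLeast0LessThan)
  then show ?thesis by (simp add: sum.nat_group[symmetric])
qed

text \<open>Taking the tube radius to be the square root of the block length balances all costs: the
  confinement and the changes of tilt contribute a bounded amount per block beyond the energy.\<close>

lemma std_BM_polygonal_tube:
  fixes V :: "nat \<Rightarrow> real"
  assumes X: "std_BM M X" and \<tau>: "0 < \<tau>" and k: "32 \<le> k" and Vn: "V n = 0"
    and c: "\<And>i. c i = \<tau> * (\<Sum>m<i div k. V m) + real (i mod k) * (\<tau> / real k) * V (i div k)"
  shows "ennreal (exp (- (\<Sum>m<n. 3 / 2 * (\<tau> * (V m)\<^sup>2) + 33)))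
    \<le> emeasure M {\<omega> \<in> space M. \<forall>i\<le>n * k. \<bar>X (real i * (\<tau> / real k)) \<omega> - c i\<bar> \<le> sqrt \<tau>}"
proof -
  define h where "h = \<tau> / real k"
  define v where "v i = V (i div k)" for i
  define r where "r = sqrt \<tau>"
  have k0: "0 < k" using k by simp
  have h: "0 < h" "real k * h = \<tau>" using \<tau> k0 by (auto simp: h_def)
  have r: "0 < r" "r\<^sup>2 = \<tau>" using \<tau> by (auto simp: r_def)
  have hr: "32 * h \<le> r\<^sup>2"
    unfolding r(2) h(2)[symmetric] using k h(1) by (intro mult_right_mono) auto
  have c_Suc: "c (Suc i) = c i + v i * h" for i
  proof (cases "Suc (i mod k) = k")
    case True
    then have "(real (i mod k) + 1) * h = \<tau>" using h(2) by (metis of_nat_Suc add.commute)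
    then have "(real (i mod k) + 1) * h * V (i div k) = \<tau> * V (i div k)" by simp
    then show ?thesis
      using True by (simp add: c div_Suc mod_Suc v_def h_def[symmetric] algebra_simps)
  next
    case False
    then show ?thesis by (simp add: c div_Suc mod_Suc v_def h_def[symmetric] algebra_simps)
  qed
  \<comment> \<open>The slope is constant on a block, so the tilt changes only in the last step
    \<open>l = k - 1\<close>. Confinement costs \<open>32 * \<tau> / r\<^sup>2 = 32\<close> per
    block.\<close>
  have blocks: "(\<Sum>i<n * k. (v i)\<^sup>2 * h / 2 + 32 * h / r\<^sup>2 + r * \<bar>v (Suc i) - v i\<bar>)
     = (\<Sum>m<n. \<tau> * (V m)\<^sup>2 / 2 + 32 + r * \<bar>V (Suc m) - V m\<bar>)"
    unfolding sum_lessThan_blocks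
  proof (rule sum.cong[OF refl])
    fix m
    have v: "v (m * k + l) = V m" if "l < k" for l using that by (simp add: v_def)
    have v': "v (Suc (m * k + l)) = (if l = k - 1 then V (Suc m) else V m)" if "l < k" for l
    proof -
      have "(m * k + l) div k = m" "(m * k + l) mod k = l" using that by auto
      then show ?thesis using that by (auto simp: v_def div_Suc simp del: div_mult_self3 mod_mult_self3)
    qed
    have "(\<Sum>l<k. (v (m * k + l))\<^sup>2 * h / 2 + 32 * h / r\<^sup>2 + r * \<bar>v (Suc (m * k + l)) - v (m * k + l)\<bar>)
      = (\<Sum>l<k. ((V m)\<^sup>2 * h / 2 + 32 * h / r\<^sup>2) + (if l = k - 1 then r * \<bar>V (Suc m) - V m\<bar> else 0))"
      by (intro sum.cong refl) (simp add: v v')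
    also have "\<dots> = real k * ((V m)\<^sup>2 * h / 2 + 32 * h / r\<^sup>2) + r * \<bar>V (Suc m) - V m\<bar>"
      using k0 by (subst sum.distrib) (simp add: sum.delta)
    also have "real k * ((V m)\<^sup>2 * h / 2 + 32 * h / r\<^sup>2) = (real k * h) * (V m)\<^sup>2 / 2 + 32 * (real k * h) / r\<^sup>2"
      by (simp add: algebra_simps)
    also have "\<dots> = \<tau> * (V m)\<^sup>2 / 2 + 32" using \<tau> by (simp add: h(2) r(2))
    finally show "(\<Sum>l<k. (v (m * k + l))\<^sup>2 * h / 2 + 32 * h / r\<^sup>2 + r * \<bar>v (Suc (m * k + l)) - v (m * k + l)\<bar>)
      = \<tau> * (V m)\<^sup>2 / 2 + 32 + r * \<bar>V (Suc m) - V m\<bar>" .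
  qed
  \<comment> \<open>The slope changes are bounded by the slopes themselves, where
    \<open>V n = 0\<close> closes the index shift, and then by the energy through
    \<open>2 * u \<le> 1 + u\<^sup>2\<close>. This turns 32 into 33 and 1/2 into 3/2.\<close>
  have "(\<Sum>m<n. \<bar>V (Suc m) - V m\<bar>) \<le> (\<Sum>m<n. \<bar>V (Suc m)\<bar> + \<bar>V m\<bar>)"
    by (intro sum_mono) (rule abs_triangle_ineq4)
  also have "\<dots> = (\<Sum>m<n. \<bar>V (Suc m)\<bar>) + (\<Sum>m<n. \<bar>V m\<bar>)" by (rule sum.distrib)
  also have "(\<Sum>m<n. \<bar>V (Suc m)\<bar>) = (\<Sum>m<n. \<bar>V m\<bar>) - \<bar>V 0\<bar>"
    using sum.lessThan_Suc_shift[of "\<lambda>m. \<bar>V m\<bar>" n] Vn by simp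
  finally have "r * (\<Sum>m<n. \<bar>V (Suc m) - V m\<bar>) \<le> r * (2 * (\<Sum>m<n. \<bar>V m\<bar>))"
    using r by (intro mult_left_mono) auto
  also have "\<dots> = (\<Sum>m<n. 2 * (r * \<bar>V m\<bar>))" by (simp add: sum_distrib_left algebra_simps)
  also have "\<dots> \<le> (\<Sum>m<n. 1 + \<tau> * (V m)\<^sup>2)"
  proof (intro sum_mono)
    fix m
    have "0 \<le> (1 - r * \<bar>V m\<bar>)\<^sup>2" by simp
    also have "\<dots> = 1 - 2 * (r * \<bar>V m\<bar>) + \<tau> * (V m)\<^sup>2"
      by (simp add: r(2)[symmetric] power2_diff power_mult_distrib)
    finally show "2 * (r * \<bar>V m\<bar>) \<le> 1 + \<tau> * (V m)\<^sup>2" by simp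
  qed
  finally have jumps: "(\<Sum>m<n. r * \<bar>V (Suc m) - V m\<bar>) \<le> (\<Sum>m<n. 1 + \<tau> * (V m)\<^sup>2)"
    by (simp add: sum_distrib_left)
  have "(\<Sum>i<n * k. (v i)\<^sup>2 * h / 2 + 32 * h / r\<^sup>2 + r * \<bar>v (Suc i) - v i\<bar>)
     = (\<Sum>m<n. \<tau> * (V m)\<^sup>2 / 2 + 32) + (\<Sum>m<n. r * \<bar>V (Suc m) - V m\<bar>)"
    unfolding blocks by (rule sum.distrib)
  also have "\<dots> \<le> (\<Sum>m<n. \<tau> * (V m)\<^sup>2 / 2 + 32) + (\<Sum>m<n. 1 + \<tau> * (V m)\<^sup>2)"
    using jumps by simp
  also have "\<dots> = (\<Sum>m<n. 3 / 2 * (\<tau> * (V m)\<^sup>2) + 33)"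
    by (subst sum.distrib[symmetric]) (rule sum.cong, auto)
  finally have "exp (- (\<Sum>m<n. 3 / 2 * (\<tau> * (V m)\<^sup>2) + 33))
    \<le> exp (- (\<Sum>i<n * k. (v i)\<^sup>2 * h / 2 + 32 * h / r\<^sup>2 + r * \<bar>v (Suc i) - v i\<bar>))" by simp
  then have "ennreal (exp (- (\<Sum>m<n. 3 / 2 * (\<tau> * (V m)\<^sup>2) + 33)))
    \<le> ennreal (exp (- (\<Sum>i<n * k. (v i)\<^sup>2 * h / 2 + 32 * h / r\<^sup>2 + r * \<bar>v (Suc i) - v i\<bar>)))"
    by (rule ennreal_leI)
  also have "\<dots> \<le> emeasure M {\<omega> \<in> space M. \<forall>i\<le>n * k. \<bar>X (real i * h) \<omega> - c i\<bar> \<le> r}"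
  proof (rule std_BM_grid_moving_tube[OF X h(1) r(1) hr])
    show "v (n * k) = 0" using k0 by (simp add: v_def Vn)
    show "c 0 = 0" using k0 by (simp add: c)
  qed (rule c_Suc)
  finally show ?thesis unfolding r_def h_def .
qed

text \<open>The line from \<open>x\<close> to \<open>y\<close> keeps distance \<open>d\<close> from
  \<open>a\<close> and \<open>b\<close>. The polygon through \<open>\<beta> * w\<close> errs by at
  most \<open>d / 2\<close>, a quarter of \<open>d\<close> from each of two block increments, and
  \<open>B0\<close> stays within \<open>sqrt \<tau> \<le> d / 2\<close> of the tilted polygon, so
  the tube is never left.\<close>

lemma tube_event_prob_ge:
  fixes n :: nat
  assumes X: "std_BM MB B0" and w: "continuous_on {0..} w" and w0: "w 0 = 0"
    and t: "0 < t" and n: "0 < n" and \<tau>_def: "\<tau> = t / real n"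
    and x: "a + d \<le> x" "x \<le> b - d" and y: "a' + d \<le> y" "y \<le> b' - d" and ab: "a \<le> a'" "b' \<le> b"
    and d: "sqrt \<tau> \<le> d / 2"
    and osc: "\<And>k u. k < n \<Longrightarrow> u \<in> {0..\<tau>} \<Longrightarrow> \<bar>\<beta>\<bar> * \<bar>w (real k * \<tau> + u) - w (real k * \<tau>)\<bar> \<le> d / 4"
  shows "exp (- (33 * real n + 3 * \<beta>\<^sup>2 * (\<Sum>k<n. (w (real (Suc k) * \<tau>) - w (real k * \<tau>))\<^sup>2 / \<tau>)
      + 3 * (y - x)\<^sup>2 / t))
    \<le> measure MB (tube_event MB B0 w \<beta> a b a' b' x t)"
proof -
  interpret prob_space MB using X by (rule std_BM_prob_space)
  note [measurable] = std_BM_measurable[OF X]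
  have \<tau>: "0 < \<tau>" "real n * \<tau> = t" using t n by (simp_all add: \<tau>_def)
  have d0: "0 \<le> d" using d real_sqrt_ge_zero[of \<tau>] \<tau> by linarith
  \<comment> \<open>Both walls in one continuous functional, whose sign along the path is what
    \<open>prob_nonneg_path\<close> handles; \<open>Q\<close> is the endpoint window.\<close>
  define F where "F s \<omega> = min (x + B0 s \<omega> - \<beta> * w s - a) (\<beta> * w s + b - (x + B0 s \<omega>))" for s \<omega>
  define Q where "Q = {\<omega> \<in> space MB. \<beta> * w t + a' \<le> x + B0 t \<omega> \<and> x + B0 t \<omega> \<le> \<beta> * w t + b'}"
  have [measurable]: "F s \<in> borel_measurable MB" for s unfolding F_def[abs_def] by measurable
  have [measurable]: "Q \<in> sets MB" unfolding Q_def by measurable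
  have tube: "tube_event MB B0 w \<beta> a b a' b' x t
      = {\<omega> \<in> space MB. (\<forall>s\<in>{0..t}. 0 \<le> F s \<omega>) \<and> \<omega> \<in> Q}"
    by (auto simp: tube_event_def F_def Q_def)
  \<comment> \<open>Slope of the tilted polygon on block \<open>m\<close>. The value 0 from
    \<open>n\<close> on provides the final slope \<open>V n = 0\<close> required by the tube
    estimate.\<close>
  define V where "V m = (if m < n then \<beta> * (w (real (Suc m) * \<tau>) - w (real m * \<tau>)) / \<tau> + (y - x) / t else 0)" for m
  have sumV: "\<tau> * (\<Sum>m<k. V m) = \<beta> * w (real k * \<tau>) + (y - x) * (real k * \<tau> / t)" if "k \<le> n" for k
    using that
  proof (induction k)
    case 0
    then show ?case using w0 by simp
  next
    case (Suc k)
    have "\<tau> * V k = \<beta> * (w (real (Suc k) * \<tau>) - w (real k * \<tau>)) + (y - x) * (\<tau> / t)"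
      using Suc.prems \<tau> by (simp add: V_def distrib_left)
    then show ?case using Suc by (simp add: algebra_simps add_divide_distrib)
  qed
  define E where "E = (\<Sum>m<n. 3 / 2 * (\<tau> * (V m)\<^sup>2) + 33)"
  have lower: "exp (- E) \<le> prob (tube_event MB B0 w \<beta> a b a' b' x t)"
    unfolding tube
  proof (rule prob_nonneg_path(2)[OF _ _ _ t, of _ _ "32 * n"])
    fix \<omega> assume "\<omega> \<in> space MB"
    then have "continuous_on {0..t} (\<lambda>s. B0 s \<omega>)" "continuous_on {0..t} w"
      by (auto intro!: continuous_on_subset[OF std_BM_continuous[OF X]] continuous_on_subset[OF w])
    then show "continuous_on {0..t} (\<lambda>s. F s \<omega>)"
      unfolding F_def by (intro continuous_intros)
  next
    fix m :: nat
    \<comment> \<open>The grids start with 32 cells per block, because confinement needs steps of at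
      most 1/32 of the squared radius, which is the block length.\<close>
    define k :: nat where "k = 32 * 2 ^ m"
    have k: "32 \<le> k" by (simp add: k_def)
    define h where "h = \<tau> / real k"
    have h: "0 < h" "real k * h = \<tau>" using \<tau> k by (auto simp: h_def)
    have h': "t / real (n * k) = h" by (simp add: h_def \<tau>_def)
    have nk: "32 * n * 2 ^ m = n * k" by (simp add: k_def)
    define c where "c i = \<tau> * (\<Sum>j<i div k. V j) + real (i mod k) * (\<tau> / real k) * V (i div k)" for i
    define G where "G = {\<omega> \<in> space MB. (\<forall>i\<le>n * k. 0 \<le> F (real i * h) \<omega>) \<and> \<omega> \<in> Q}"
    have [measurable]: "G \<in> sets MB" unfolding G_def by measurable
    have time: "real i * h = real (i div k) * \<tau> + real (i mod k) * h" for i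
    proof -
      have "real i = real (i div k * k + i mod k)" by simp
      also have "\<dots> = real (i div k) * real k + real (i mod k)" by (simp only: of_nat_add of_nat_mult)
      finally show ?thesis by (simp add: h(2)[symmetric] algebra_simps)
    qed
    have c_end: "c (n * k) = \<beta> * w t + (y - x)"
      using sumV[of n] k \<tau> t by (simp add: c_def V_def)
    \<comment> \<open>The last index belongs to block \<open>n\<close>, beyond the polygon, and is
      treated apart. Elsewhere the difference is the interpolation error of
      \<open>\<beta> * w\<close> on one block.\<close>
    have c_near: "\<bar>c i - \<beta> * w (real i * h) - (y - x) * (real i * h / t)\<bar> \<le> d / 2" if i: "i \<le> n * k" for i
    proof (cases "i = n * k")
      case True
      have "real i * h = t" using True h(2) \<tau>(2) by (simp add: mult.assoc)
      then show ?thesis using True c_end t d0 by simp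
    next
      case False
      define j l where "j = i div k" and "l = real (i mod k) * h"
      have j: "j < n" using False i k by (simp add: j_def less_mult_imp_div_less)
      have "real (i mod k) \<le> real k" using k by (simp add: less_imp_le)
      then have "l \<le> real k * h" unfolding l_def using h(1) by (intro mult_right_mono) auto
      then have l: "0 \<le> l" "l \<le> \<tau>" using h by (auto simp: l_def)
      have s: "real i * h = real j * \<tau> + l" unfolding j_def l_def by (rule time)
      have "l * V j = (l / \<tau>) * (\<beta> * (w (real (Suc j) * \<tau>) - w (real j * \<tau>))) + (y - x) * (l / t)"
        using j by (simp add: V_def distrib_left)
      then have "c i - \<beta> * w (real i * h) - (y - x) * (real i * h / t)
        = (l / \<tau>) * (\<beta> * (w (real j * \<tau> + \<tau>) - w (real j * \<tau>))) - \<beta> * (w (real j * \<tau> + l) - w (real j * \<tau>))"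
        using sumV[of j] j unfolding c_def s j_def[symmetric] h_def[symmetric] l_def[symmetric]
        by (simp add: algebra_simps add_divide_distrib)
      also have "\<bar>\<dots>\<bar> \<le> \<bar>(l / \<tau>) * (\<beta> * (w (real j * \<tau> + \<tau>) - w (real j * \<tau>)))\<bar>
          + \<bar>\<beta> * (w (real j * \<tau> + l) - w (real j * \<tau>))\<bar>" by (rule abs_triangle_ineq4)
      also have "\<dots> \<le> 1 * (d / 4) + d / 4"
        unfolding abs_mult using l \<tau> j by (intro add_mono mult_mono osc) (auto simp: divide_le_eq)
      finally show ?thesis by simp
    qed
    have "{\<omega> \<in> space MB. \<forall>i\<le>n * k. \<bar>B0 (real i * h) \<omega> - c i\<bar> \<le> sqrt \<tau>} \<subseteq> G"
    proof
      fix \<omega> assume \<omega>: "\<omega> \<in> {\<omega> \<in> space MB. \<forall>i\<le>n * k. \<bar>B0 (real i * h) \<omega> - c i\<bar> \<le> sqrt \<tau>}"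
      have "0 \<le> F (real i * h) \<omega>" if i: "i \<le> n * k" for i
      proof -
        define \<sigma> where "\<sigma> = real i * h / t"
        have "real i \<le> real (n * k)" using i by (simp only: of_nat_le_iff)
        then have "real i * h \<le> real (n * k) * h" using h by (intro mult_right_mono) auto
        also have "\<dots> = t" using h(2) \<tau>(2) by (simp add: mult.assoc)
        finally have \<sigma>: "0 \<le> \<sigma>" "\<sigma> \<le> 1" using t h by (auto simp: \<sigma>_def)
        \<comment> \<open>A convex combination of \<open>x\<close> and \<open>y\<close>, both of
          which lie between \<open>a + d\<close> and \<open>b - d\<close>.\<close>
        have "x + (y - x) * \<sigma> = (1 - \<sigma>) * x + \<sigma> * y" by (simp add: algebra_simps)
        moreover have "(1 - \<sigma>) * (a + d) + \<sigma> * (a + d) \<le> (1 - \<sigma>) * x + \<sigma> * y"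
          using \<sigma> x y ab by (intro add_mono mult_left_mono) auto
        moreover have "(1 - \<sigma>) * x + \<sigma> * y \<le> (1 - \<sigma>) * (b - d) + \<sigma> * (b - d)"
          using \<sigma> x y ab by (intro add_mono mult_left_mono) auto
        ultimately have "a + d \<le> x + (y - x) * \<sigma>" "x + (y - x) * \<sigma> \<le> b - d"
          by (simp_all add: algebra_simps)
        moreover have "\<bar>B0 (real i * h) \<omega> - c i\<bar> \<le> d / 2" using \<omega> i d by force
        ultimately show ?thesis
          using c_near[OF i] unfolding F_def \<sigma>_def[symmetric] by (intro min.boundedI) linarith+
      qed
      moreover have "\<omega> \<in> Q"
      proof -
        have "real (n * k) * h = t" using h(2) \<tau>(2) by (simp add: mult.assoc)
        then have "\<bar>B0 t \<omega> - (\<beta> * w t + (y - x))\<bar> \<le> sqrt \<tau>" using \<omega> c_end by force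
        then show ?thesis using \<omega> d d0 y unfolding Q_def by (simp add: abs_le_iff)
      qed
      ultimately show "\<omega> \<in> G" using \<omega> by (simp add: G_def)
    qed
    then have "emeasure MB {\<omega> \<in> space MB. \<forall>i\<le>n * k. \<bar>B0 (real i * h) \<omega> - c i\<bar> \<le> sqrt \<tau>} \<le> emeasure MB G"
      by (rule emeasure_mono) simp
    moreover have "ennreal (exp (- E)) \<le> emeasure MB {\<omega> \<in> space MB. \<forall>i\<le>n * k. \<bar>B0 (real i * h) \<omega> - c i\<bar> \<le> sqrt \<tau>}"
      unfolding E_def h_def by (rule std_BM_polygonal_tube[OF X \<tau>(1) k _ c_def]) (simp add: V_def)
    ultimately have "ennreal (exp (- E)) \<le> emeasure MB G" by (rule order_trans[rotated])
    then have "exp (- E) \<le> prob G" by (simp add: emeasure_eq_measure)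
    then show "exp (- E) \<le> prob {\<omega> \<in> space MB. (\<forall>i\<le>32 * n * 2 ^ m.
        0 \<le> F (real i * (t / real (32 * n * 2 ^ m))) \<omega>) \<and> \<omega> \<in> Q}"
      unfolding nk h' G_def .
  qed (use n in auto)
  have upper: "E \<le> 33 * real n + 3 * \<beta>\<^sup>2 * (\<Sum>k<n. (w (real (Suc k) * \<tau>) - w (real k * \<tau>))\<^sup>2 / \<tau>)
      + 3 * (y - x)\<^sup>2 / t"
  proof -
    define D where "D k = w (real (Suc k) * \<tau>) - w (real k * \<tau>)" for k
    have "E \<le> (\<Sum>m<n. (3 * \<beta>\<^sup>2 * ((D m)\<^sup>2 / \<tau>) + 33) + 3 * (y - x)\<^sup>2 / (t * real n))"
      unfolding E_def
    proof (intro sum_mono)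
      fix m assume "m \<in> {..<n}"
      then have V: "V m = \<beta> * D m / \<tau> + (y - x) / t" by (simp add: V_def D_def)
      \<comment> \<open>Separates the increments of \<open>w\<close> from the linear tilt; the
        tilt's share, summed over \<open>n\<close> blocks, does not grow with
        \<open>n\<close>.\<close>
      have "(V m)\<^sup>2 \<le> 2 * (\<beta> * D m / \<tau>)\<^sup>2 + 2 * ((y - x) / t)\<^sup>2"
        unfolding V using sum_squares_bound[of "\<beta> * D m / \<tau>" "(y - x) / t"] by (simp add: power2_sum)
      then have "\<tau> * (V m)\<^sup>2 \<le> \<tau> * (2 * (\<beta> * D m / \<tau>)\<^sup>2 + 2 * ((y - x) / t)\<^sup>2)"
        using \<tau> by (intro mult_left_mono) auto
      also have "\<dots> = 2 * (\<beta>\<^sup>2 * ((D m)\<^sup>2 / \<tau>)) + 2 * ((y - x)\<^sup>2 * (\<tau> / t\<^sup>2))"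
        using \<tau> by (simp add: power_divide power_mult_distrib power2_eq_square[of \<tau>] algebra_simps)
      also have "\<tau> / t\<^sup>2 = 1 / (t * real n)"
        using t n by (simp add: \<tau>_def power2_eq_square)
      finally show "3 / 2 * (\<tau> * (V m)\<^sup>2) + 33 \<le> (3 * \<beta>\<^sup>2 * ((D m)\<^sup>2 / \<tau>) + 33) + 3 * (y - x)\<^sup>2 / (t * real n)"
        by simp
    qed
    also have "\<dots> = 33 * real n + 3 * \<beta>\<^sup>2 * (\<Sum>m<n. (D m)\<^sup>2 / \<tau>) + 3 * (y - x)\<^sup>2 / t"
      using n t by (simp add: sum.distrib sum_distrib_left)
    finally show ?thesis by (simp add: D_def)
  qed
  show ?thesis
    by (rule order_trans[OF iffD2[OF exp_le_cancel_iff le_imp_neg_le[OF upper]] lower])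
qed

section \<open>Oscillation and squared increments of \<open>W\<close>\<close>

lemma std_BM_maximal:
  assumes X: "std_BM M X" and s: "0 \<le> s" and \<tau>: "0 < \<tau>" and \<epsilon>: "0 < \<epsilon>"
  shows "{\<omega> \<in> space M. \<forall>u\<in>{0..\<tau>}. \<bar>X (s + u) \<omega> - X s \<omega>\<bar> \<le> \<epsilon>} \<in> sets M" (is "?E \<in> _")
    and "1 - 2 * exp (- \<epsilon>\<^sup>2 / (2 * \<tau>)) \<le> measure M {\<omega> \<in> space M. \<forall>u\<in>{0..\<tau>}. \<bar>X (s + u) \<omega> - X s \<omega>\<bar> \<le> \<epsilon>}"
proof -
  interpret prob_space M using X by (rule std_BM_prob_space)
  note [measurable] = std_BM_measurable[OF X]
  define F where "F u \<omega> = \<epsilon> - \<bar>X (s + u) \<omega> - X s \<omega>\<bar>" for u \<omega>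
  have F: "F u \<in> borel_measurable M" for u unfolding F_def[abs_def] by measurable
  have cont: "continuous_on {0..\<tau>} (\<lambda>u. F u \<omega>)" if "\<omega> \<in> space M" for \<omega>
    unfolding F_def using s
    by (intro continuous_intros continuous_on_compose2[OF std_BM_continuous[OF X that]]) auto
  have E: "?E = {\<omega> \<in> space M. (\<forall>u\<in>{0..\<tau>}. 0 \<le> F u \<omega>) \<and> \<omega> \<in> space M}"
    by (auto simp: F_def)
  show "?E \<in> sets M"
    unfolding E using prob_nonneg_path(1)[OF F cont sets.top \<tau>, of 1] by simp
  have "1 - 2 * exp (- \<epsilon>\<^sup>2 / (2 * \<tau>)) \<le> prob {\<omega> \<in> space M. (\<forall>u\<in>{0..\<tau>}. 0 \<le> F u \<omega>) \<and> \<omega> \<in> space M}"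
  proof (rule prob_nonneg_path(2)[OF F cont sets.top \<tau>, of 1])
    fix m :: nat
    define h where "h = \<tau> / real (1 * 2 ^ m)"
    have h: "0 < h" "real (2 ^ m) * h = \<tau>" using \<tau> by (auto simp: h_def)
    \<comment> \<open>Every grid has total length \<open>\<tau>\<close>, so the bound is the same
      for all of them.\<close>
    have "ennreal (1 - 2 * exp (- \<epsilon>\<^sup>2 / (2 * (real (2 ^ m) * h))))
      \<le> emeasure M {\<omega> \<in> space M. \<forall>i\<le>2 ^ m. \<bar>X (s + real i * h) \<omega> - X s \<omega>\<bar> \<le> \<epsilon>}"
      by (rule std_BM_grid_maximal[OF X s h(1) \<epsilon>]) simp
    also have "{\<omega> \<in> space M. \<forall>i\<le>2 ^ m. \<bar>X (s + real i * h) \<omega> - X s \<omega>\<bar> \<le> \<epsilon>}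
      = {\<omega> \<in> space M. (\<forall>i\<le>1 * 2 ^ m. 0 \<le> F (real i * h) \<omega>) \<and> \<omega> \<in> space M}"
      by (auto simp: F_def)
    finally show "1 - 2 * exp (- \<epsilon>\<^sup>2 / (2 * \<tau>)) \<le> prob {\<omega> \<in> space M. (\<forall>i\<le>1 * 2 ^ m.
        0 \<le> F (real i * (\<tau> / real (1 * 2 ^ m))) \<omega>) \<and> \<omega> \<in> space M}"
      unfolding h(2) h_def[symmetric] by (simp add: emeasure_eq_measure)
  qed auto
  then show "1 - 2 * exp (- \<epsilon>\<^sup>2 / (2 * \<tau>)) \<le> prob ?E" unfolding E .
qed

text \<open>The weight changes the Gaussian of variance \<open>h\<close> into one of variance
  \<open>2 * h\<close>; \<open>sqrt 2\<close> is the ratio of the normalising constants.\<close>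

lemma nn_integral_gauss_exp_square:
  assumes h: "0 < h"
  shows "(\<integral>\<^sup>+z. ennreal (exp (z\<^sup>2 / h / 4)) \<partial>gauss h) = ennreal (sqrt 2)"
proof -
  interpret prob_space "gauss (2 * h)" using h by (intro prob_space_gauss) simp
  have e: "normal_density 0 (sqrt h) z * exp (z\<^sup>2 / h / 4) = sqrt 2 * normal_density 0 (sqrt (2 * h)) z" for z
  proof -
    have "- z\<^sup>2 / (2 * h) + z\<^sup>2 / h / 4 = - z\<^sup>2 / (2 * (2 * h))" using h by (simp add: field_simps)
    then have "exp (- z\<^sup>2 / (2 * h)) * exp (z\<^sup>2 / h / 4) = exp (- z\<^sup>2 / (2 * (2 * h)))"
      by (simp only: exp_add[symmetric])
    moreover have "sqrt (2 * pi * (2 * h)) = sqrt 2 * sqrt (2 * pi * h)"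
      by (simp only: real_sqrt_mult[symmetric]) (simp add: ac_simps)
    ultimately show ?thesis using h by (simp add: normal_density_def)
  qed
  have "(\<integral>\<^sup>+z. ennreal (exp (z\<^sup>2 / h / 4)) \<partial>gauss h)
    = (\<integral>\<^sup>+z. ennreal (sqrt 2 * normal_density 0 (sqrt (2 * h)) z) \<partial>lborel)"
    unfolding e[symmetric] by (subst nn_integral_gauss) (simp_all add: ennreal_mult)
  also have "\<dots> = ennreal (sqrt 2) * (\<integral>\<^sup>+z. ennreal (normal_density 0 (sqrt (2 * h)) z) * 1 \<partial>lborel)"
    by (simp add: ennreal_mult nn_integral_cmult)
  also have "(\<integral>\<^sup>+z. ennreal (normal_density 0 (sqrt (2 * h)) z) * 1 \<partial>lborel) = (\<integral>\<^sup>+z. 1 \<partial>gauss (2 * h))"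
    by (rule nn_integral_gauss[symmetric]) simp
  also have "\<dots> = 1" using emeasure_space_1 by simp
  finally show ?thesis by simp
qed

text \<open>Chernoff bound with exponent 1/4: on the event the exponential is at least
  \<open>exp n\<close>, while its expectation is \<open>sqrt 2 ^ n\<close>, at most
  \<open>exp (n / 2)\<close>.\<close>

lemma std_BM_quadratic_variation:
  assumes X: "std_BM M X" and \<tau>: "0 < \<tau>"
  shows "{\<omega> \<in> space M. 4 * real n < (\<Sum>k<n. (X (real (Suc k) * \<tau>) \<omega> - X (real k * \<tau>) \<omega>)\<^sup>2 / \<tau>)} \<in> sets M" (is "?E \<in> _")
    and "measure M {\<omega> \<in> space M. 4 * real n < (\<Sum>k<n. (X (real (Suc k) * \<tau>) \<omega> - X (real k * \<tau>) \<omega>)\<^sup>2 / \<tau>)}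
      \<le> exp (- (real n / 2))"
proof -
  interpret prob_space M using X by (rule std_BM_prob_space)
  note [measurable] = std_BM_measurable[OF X]
  define \<xi> where "\<xi> k \<omega> = X (0 + real (Suc k) * \<tau>) \<omega> - X (0 + real k * \<tau>) \<omega>" for k \<omega>
  have [measurable]: "\<xi> k \<in> borel_measurable M" for k unfolding \<xi>_def[abs_def] by measurable
  define Y where "Y z = ennreal (exp (z\<^sup>2 / \<tau> / 4))" for z
  have [measurable]: "Y \<in> borel_measurable borel" unfolding Y_def[abs_def] by measurable
  have E: "?E = {\<omega> \<in> space M. 4 * real n < (\<Sum>k<n. (\<xi> k \<omega>)\<^sup>2 / \<tau>)}" by (simp add: \<xi>_def)
  show [measurable]: "?E \<in> sets M" unfolding E by measurable
  have "indep_vars (\<lambda>_. borel) \<xi> {..<n}"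
    unfolding \<xi>_def by (rule std_BM_indep_increments[OF X order_refl \<tau>])
  then have ind: "indep_vars (\<lambda>_. borel) (\<lambda>k \<omega>. Y (\<xi> k \<omega>)) {..<n}"
    by (rule indep_vars_compose2) simp
  have "distr M borel (\<xi> k) = gauss ((0 + real (Suc k) * \<tau>) - (0 + real k * \<tau>))" for k
    unfolding \<xi>_def using \<tau> by (intro std_BM_distr_increment[OF X]) (auto simp: algebra_simps)
  then have d: "distr M borel (\<xi> k) = gauss \<tau>" for k by (simp add: algebra_simps)
  have Y: "(\<integral>\<^sup>+\<omega>. Y (\<xi> k \<omega>) \<partial>M) = ennreal (sqrt 2)" for k
    using nn_integral_distr[of "\<xi> k" M borel Y] nn_integral_gauss_exp_square[OF \<tau>]
    unfolding d Y_def by simp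
  have "ennreal (exp (real n)) * emeasure M ?E = (\<integral>\<^sup>+\<omega>. ennreal (exp (real n)) * indicator ?E \<omega> \<partial>M)"
    by (simp add: nn_integral_cmult_indicator)
  also have "\<dots> \<le> (\<integral>\<^sup>+\<omega>. (\<Prod>k<n. Y (\<xi> k \<omega>)) \<partial>M)"
  proof (intro nn_integral_mono)
    fix \<omega>
    have "(\<Prod>k<n. Y (\<xi> k \<omega>)) = ennreal (exp (\<Sum>k<n. (\<xi> k \<omega>)\<^sup>2 / \<tau> / 4))"
      unfolding Y_def by (subst prod_ennreal) (simp_all add: exp_sum)
    moreover have "exp (real n) \<le> exp (\<Sum>k<n. (\<xi> k \<omega>)\<^sup>2 / \<tau> / 4)" if "\<omega> \<in> ?E"
      using that unfolding E by (simp add: sum_divide_distrib[symmetric])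
    ultimately show "ennreal (exp (real n)) * indicator ?E \<omega> \<le> (\<Prod>k<n. Y (\<xi> k \<omega>))"
      by (auto simp: indicator_def intro!: ennreal_leI simp del: exp_le_cancel_iff)
  qed
  also have "\<dots> = ennreal (sqrt 2) ^ n"
    by (subst indep_vars_nn_integral[OF _ ind]) (simp_all add: Y)
  finally have "exp (real n) * prob ?E \<le> sqrt 2 ^ n"
    by (simp add: emeasure_eq_measure ennreal_power flip: ennreal_mult)
  also have "\<dots> \<le> exp (1 / 2) ^ n"
  proof (intro power_mono)
    have "2 \<le> exp (1 / 2 + 1 / 2 :: real)" using exp_ge_add_one_self[of 1] by simp
    then have "2 \<le> (exp (1 / 2 :: real))\<^sup>2" unfolding exp_add by (simp add: power2_eq_square)
    then show "sqrt 2 \<le> exp (1 / 2)" by (simp add: real_le_lsqrt)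
  qed simp
  also have "\<dots> = exp (real n / 2)" by (simp add: exp_of_nat_mult[symmetric])
  finally have "prob ?E \<le> exp (real n / 2) / exp (real n)" by (simp add: field_simps)
  also have "\<dots> = exp (- (real n / 2))" by (simp add: exp_diff[symmetric])
  finally show "prob ?E \<le> exp (- (real n / 2))" .
qed

section \<open>The tail of the random variable\<close>

text \<open>A positive bound uniform in \<open>x\<close> keeps the infimum away from 0 and so
  excludes the infinite value.\<close>

lemma Xbar_leI:
  assumes "a0 \<le> b0"
    and "\<And>x. x \<in> {a0..b0} \<Longrightarrow> exp (- L) \<le> measure MB (tube_event MB B0 (\<lambda>s. W s \<omega>) \<beta> a b a' b' x t)"
  shows "Xbar MB B0 W \<beta> a b a' b' a0 b0 t \<omega> \<le> ereal L"
proof -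
  define I where "I = (INF x\<in>{a0..b0}. measure MB (tube_event MB B0 (\<lambda>s. W s \<omega>) \<beta> a b a' b' x t))"
  have I: "exp (- L) \<le> I" unfolding I_def using assms by (intro cINF_greatest) auto
  then have "0 < I" by (rule less_le_trans[OF exp_gt_zero])
  moreover from this have "- L \<le> ln I" using I by (simp add: ln_ge_iff)
  ultimately show ?thesis by (simp add: Xbar_def I_def[symmetric] Let_def)
qed

text \<open>\<open>n\<close> is both the number of blocks and the scale of the bound.
  \<open>Bad n\<close> occurs if \<open>W\<close> oscillates by more than \<open>\<epsilon>\<close>
  on some block or if its normalised squared increments sum to more than \<open>4 * n\<close>.
  Measurable exceptional sets stand in for the level sets of \<open>Xbar\<close>, whose
  measurability is not established.\<close>

lemma Xbar_exponential_tail: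
  fixes MB :: "'a measure" and MW :: "'b measure"
  assumes B: "std_BM MB B0" and W: "std_BM MW W"
    and ab: "a < a0" "a0 \<le> b0" "b0 < b" "a \<le> a'" "a' < b'" "b' \<le> b" and t: "0 < t"
  obtains L \<kappa> :: real and N :: nat and Bad :: "nat \<Rightarrow> 'b set"
  where "1 \<le> L" "0 < \<kappa>" "\<And>n. N \<le> n \<Longrightarrow> Bad n \<in> sets MW"
    "\<And>n. N \<le> n \<Longrightarrow> measure MW (Bad n) \<le> (2 * real n + 1) * exp (- \<kappa> * real n)"
    "\<And>n \<omega>. N \<le> n \<Longrightarrow> \<omega> \<in> space MW \<Longrightarrow> \<omega> \<notin> Bad n \<Longrightarrow>
      Xbar MB B0 W \<beta> a b a' b' a0 b0 t \<omega> \<le> ereal (L * real n)"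
proof -
  interpret prob_space MW using W by (rule std_BM_prob_space)
  \<comment> \<open>Clearance: all starting points stay \<open>d\<close> away from \<open>a\<close>
    and \<open>b\<close>, and the midpoint \<open>y\<close> stays \<open>d\<close> away from
    \<open>a'\<close> and \<open>b'\<close>.\<close>
  define d where "d = min (min (a0 - a) (b - b0)) ((b' - a') / 2)"
  define y where "y = (a' + b') / 2"
  \<comment> \<open>Chosen so that \<open>\<bar>\<beta>\<bar> * \<epsilon> \<le> d / 4\<close>; the
    added 1 covers \<open>\<beta> = 0\<close>.\<close>
  define \<epsilon> where "\<epsilon> = d / (4 * (\<bar>\<beta>\<bar> + 1))"
  \<comment> \<open>Collects the cost per block: 33, then \<open>3 * \<beta>\<^sup>2\<close> times
    the allowed 4, then the tilt cost, which is bounded and absorbed because \<open>n\<close> is at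
    least 1.\<close>
  define L where "L = 33 + 12 * \<beta>\<^sup>2 + 3 * (b - a)\<^sup>2 / t"
  define \<kappa> where "\<kappa> = min (\<epsilon>\<^sup>2 / (2 * t)) (1 / 2)"
  \<comment> \<open>From \<open>N\<close> on, \<open>n\<close> is positive and
    \<open>sqrt (t / n) \<le> d / 2\<close>.\<close>
  define N where "N = nat \<lceil>4 * t / d\<^sup>2\<rceil> + 1"
  define \<tau> where "\<tau> n = t / real n" for n
  define E where "E n k = {\<omega> \<in> space MW. \<forall>u\<in>{0..\<tau> n}. \<bar>W (real k * \<tau> n + u) \<omega> - W (real k * \<tau> n) \<omega>\<bar> \<le> \<epsilon>}" for n k
  define V where "V n = {\<omega> \<in> space MW. 4 * real n <
    (\<Sum>k<n. (W (real (Suc k) * \<tau> n) \<omega> - W (real k * \<tau> n) \<omega>)\<^sup>2 / \<tau> n)}" for n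
  define Bad where "Bad n = (\<Union>k<n. space MW - E n k) \<union> V n" for n
  have d: "0 < d" using ab by (simp add: d_def)
  have \<epsilon>: "0 < \<epsilon>" using d by (simp add: \<epsilon>_def)
  have n_pos: "0 < n" if "N \<le> n" for n using that by (simp add: N_def)
  have \<tau>: "0 < \<tau> n" if "N \<le> n" for n using t n_pos[OF that] by (simp add: \<tau>_def)
  have E_sets: "E n k \<in> sets MW" if "N \<le> n" for n k
    unfolding E_def using \<tau>[OF that] by (intro std_BM_maximal(1)[OF W _ _ \<epsilon>]) auto
  have V_sets: "V n \<in> sets MW" if "N \<le> n" for n
    unfolding V_def by (rule std_BM_quadratic_variation(1)[OF W \<tau>[OF that]])
  show thesis
  proof (rule that)
    show "1 \<le> L" using t by (simp add: L_def)
    show "0 < \<kappa>" using \<epsilon> t by (simp add: \<kappa>_def)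
    show "Bad n \<in> sets MW" if "N \<le> n" for n
      unfolding Bad_def using E_sets[OF that] V_sets[OF that]
      by (intro sets.Un sets.finite_UN sets.Diff sets.top) auto
    show "measure MW (Bad n) \<le> (2 * real n + 1) * exp (- \<kappa> * real n)" if "N \<le> n" for n
    proof -
      have "prob (space MW - E n k) \<le> 2 * exp (- \<kappa> * real n)" for k
      proof -
        have "1 - 2 * exp (- \<epsilon>\<^sup>2 / (2 * \<tau> n)) \<le> prob (E n k)"
          unfolding E_def using \<tau>[OF that] by (intro std_BM_maximal(2)[OF W _ _ \<epsilon>]) auto
        then have "prob (space MW - E n k) \<le> 2 * exp (- \<epsilon>\<^sup>2 / (2 * \<tau> n))"
          using prob_compl[OF E_sets[OF that]] by simp
        also have "- \<epsilon>\<^sup>2 / (2 * \<tau> n) = - (\<epsilon>\<^sup>2 / (2 * t)) * real n" by (simp add: \<tau>_def)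
        also have "2 * exp (- (\<epsilon>\<^sup>2 / (2 * t)) * real n) \<le> 2 * exp (- \<kappa> * real n)"
          using mult_right_mono[of \<kappa> "\<epsilon>\<^sup>2 / (2 * t)" "real n"] by (simp add: \<kappa>_def)
        finally show ?thesis .
      qed
      then have "(\<Sum>k<n. prob (space MW - E n k)) \<le> (\<Sum>k<n. 2 * exp (- \<kappa> * real n))"
        by (intro sum_mono)
      moreover have "prob (\<Union>k<n. space MW - E n k) \<le> (\<Sum>k<n. prob (space MW - E n k))"
        using E_sets[OF that] by (intro finite_measure_subadditive_finite) auto
      moreover have "prob (V n) \<le> exp (- \<kappa> * real n)"
      proof -
        have "prob (V n) \<le> exp (- (real n / 2))"
          unfolding V_def by (rule std_BM_quadratic_variation(2)[OF W \<tau>[OF that]])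
        also have "\<dots> \<le> exp (- \<kappa> * real n)"
          using mult_right_mono[of \<kappa> "1/2" "real n"] by (simp add: \<kappa>_def)
        finally show ?thesis .
      qed
      moreover have "prob (Bad n) \<le> prob (\<Union>k<n. space MW - E n k) + prob (V n)"
        unfolding Bad_def using E_sets[OF that] V_sets[OF that]
        by (intro measure_Un_le sets.finite_UN sets.Diff sets.top) auto
      ultimately show ?thesis by (simp add: algebra_simps)
    qed
    show "Xbar MB B0 W \<beta> a b a' b' a0 b0 t \<omega> \<le> ereal (L * real n)"
      if n: "N \<le> n" and \<omega>: "\<omega> \<in> space MW" "\<omega> \<notin> Bad n" for n \<omega>
    proof (rule Xbar_leI[OF ab(2)])
      fix x assume x: "x \<in> {a0..b0}"
      let ?S = "\<Sum>k<n. (W (real (Suc k) * \<tau> n) \<omega> - W (real k * \<tau> n) \<omega>)\<^sup>2 / \<tau> n"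
      have S: "?S \<le> 4 * real n" using \<omega> by (auto simp: Bad_def V_def)
      have "4 * t / d\<^sup>2 \<le> real n" using n unfolding N_def by linarith
      then have "\<tau> n \<le> (d / 2)\<^sup>2"
        using d n_pos[OF n] by (simp add: \<tau>_def field_simps power2_eq_square)
      then have sqrt_le: "sqrt (\<tau> n) \<le> d / 2" using d by (intro real_le_lsqrt) auto
      have lower: "exp (- (33 * real n + 3 * \<beta>\<^sup>2 * ?S + 3 * (y - x)\<^sup>2 / t))
        \<le> measure MB (tube_event MB B0 (\<lambda>s. W s \<omega>) \<beta> a b a' b' x t)"
      proof (rule tube_event_prob_ge[OF B _ _ t n_pos[OF n] \<tau>_def _ _ _ _ ab(4) ab(6) sqrt_le])
        show "continuous_on {0..} (\<lambda>s. W s \<omega>)" "W 0 \<omega> = 0"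
          using W \<omega>(1) by (auto intro: std_BM_continuous std_BM_0)
        have dd: "d \<le> a0 - a" "d \<le> b - b0" "d \<le> (b' - a') / 2"
          unfolding d_def by linarith+
        show "a + d \<le> x" "x \<le> b - d" using dd x by auto
        show "a' + d \<le> y" "y \<le> b' - d" using dd by (simp_all add: y_def field_simps)
        show "\<bar>\<beta>\<bar> * \<bar>W (real k * \<tau> n + u) \<omega> - W (real k * \<tau> n) \<omega>\<bar> \<le> d / 4"
          if "k < n" "u \<in> {0..\<tau> n}" for k u
        proof -
          have "\<bar>W (real k * \<tau> n + u) \<omega> - W (real k * \<tau> n) \<omega>\<bar> \<le> \<epsilon>"
            using \<omega> that by (auto simp: Bad_def E_def)
          then have "\<bar>\<beta>\<bar> * \<bar>W (real k * \<tau> n + u) \<omega> - W (real k * \<tau> n) \<omega>\<bar> \<le> (\<bar>\<beta>\<bar> + 1) * \<epsilon>"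
            by (intro mult_mono) auto
          also have "\<dots> = d / 4" by (simp add: \<epsilon>_def field_simps)
          finally show ?thesis .
        qed
      qed
      have upper: "33 * real n + 3 * \<beta>\<^sup>2 * ?S + 3 * (y - x)\<^sup>2 / t \<le> L * real n"
      proof -
        have "\<bar>y - x\<bar> \<le> b - a" using ab x by (auto simp: y_def abs_le_iff field_simps)
        then have "(y - x)\<^sup>2 \<le> (b - a)\<^sup>2" using abs_le_square_iff[of "y - x" "b - a"] by simp
        then have "3 * (y - x)\<^sup>2 / t \<le> 3 * (b - a)\<^sup>2 / t * 1"
          using t by (simp add: divide_right_mono)
        also have "\<dots> \<le> 3 * (b - a)\<^sup>2 / t * real n"
          using n_pos[OF n] t by (intro mult_left_mono) auto
        finally have "3 * (y - x)\<^sup>2 / t \<le> 3 * (b - a)\<^sup>2 / t * real n" .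
        moreover have "3 * \<beta>\<^sup>2 * ?S \<le> 3 * \<beta>\<^sup>2 * (4 * real n)"
          by (rule mult_left_mono[OF S]) simp
        moreover have "L * real n = 33 * real n + 3 * \<beta>\<^sup>2 * (4 * real n) + 3 * (b - a)\<^sup>2 / t * real n"
          by (simp add: L_def distrib_right)
        ultimately show ?thesis by linarith
      qed
      show "exp (- (L * real n)) \<le> measure MB (tube_event MB B0 (\<lambda>s. W s \<omega>) \<beta> a b a' b' x t)"
        by (rule order_trans[OF iffD2[OF exp_le_cancel_iff le_imp_neg_le[OF upper]] lower])
    qed
  qed
qed

text \<open>Since \<open>q > 1\<close>, the exponent of order \<open>ln n powr q\<close> outweighs
  \<open>p * ln n\<close>.\<close>

lemma tail_bound_tendsto_0:
  fixes p q \<kappa> c :: real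
  assumes "0 < p" "1 < q" "0 < \<kappa>" "0 < c"
  shows "(\<lambda>n::nat. real n powr p * ((2 * (c * ln (real n) powr q) + 1) *
      exp (- \<kappa> * (c * ln (real n) powr q - 1)))) \<longlonglongrightarrow> 0"
  using assms by real_asymp

text \<open>Half of the decay rate absorbs the polynomial, and the other half leaves a geometric
  series.\<close>

lemma summable_poly_exp:
  fixes \<kappa> L :: real
  assumes "0 < \<kappa>" "1 \<le> L"
  shows "summable (\<lambda>n::nat. (L * real (Suc n)) ^ j * ((2 * real n + 1) * exp (- \<kappa> * real n)))"
proof (rule summable_comparison_test_bigo)
  have "summable (\<lambda>n::nat. exp (- \<kappa> / 2) ^ n :: real)"
    by (rule summable_geometric) (use assms in simp)
  then show "summable (\<lambda>n::nat. norm (exp (- \<kappa> / 2 * real n)))"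
    by (simp only: exp_of_nat2_mult real_norm_def power_abs abs_exp_cancel)
  show "(\<lambda>n::nat. (L * real (Suc n)) ^ j * ((2 * real n + 1) * exp (- \<kappa> * real n)))
      \<in> O(\<lambda>n. exp (- \<kappa> / 2 * real n))"
    using assms by real_asymp
qed

lemma suminf_ennreal_eq_top:
  fixes f :: "nat \<Rightarrow> ennreal"
  assumes "\<And>n. 1 \<le> f n"
  shows "(\<Sum>n. f n) = \<infinity>"
proof (rule ccontr)
  assume "(\<Sum>n. f n) \<noteq> \<infinity>"
  then have "(\<Sum>n. f n) < top" by (simp add: top.not_eq_extremum)
  then obtain n where "(\<Sum>n. f n) < of_nat n" using ennreal_Ex_less_of_nat by blast
  also have "of_nat n = (\<Sum>i<n. 1 :: ennreal)" by simp
  also have "\<dots> \<le> (\<Sum>i<n. f i)" using assms by (intro sum_mono)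
  also have "\<dots> \<le> (\<Sum>n. f n)" by (intro sum_le_suminf) auto
  finally show False by simp
qed

theorem theorem3p1:
  fixes MB :: "'a measure" and MW :: "'b measure"
    and B0 :: "real \<Rightarrow> 'a \<Rightarrow> real" and W :: "real \<Rightarrow> 'b \<Rightarrow> real"
    and \<beta> a b a' b' a0 b0 t p q :: real
  assumes "std_BM MB B0" and "std_BM MW W"
    and "a < a0" and "a0 \<le> b0" and "b0 < b" and "a \<le> a'" and "a' < b'" and "b' \<le> b"
    and "t > 0" and "p > 0" and "q > 1"
  shows "((\<lambda>n::nat. real n powr p *
            measure MW {\<omega> \<in> space MW.
              Xbar MB B0 W \<beta> a b a' b' a0 b0 t \<omega> \<ge> ereal ((ln (real n)) powr q)})
           \<longlonglongrightarrow> 0) \<and>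
         (\<forall>j::nat. (\<integral>\<^sup>+ \<omega>. e2ennreal (Xbar MB B0 W \<beta> a b a' b' a0 b0 t \<omega>) ^ j \<partial>MW) < \<infinity>)"
proof -
  interpret prob_space MW using assms(2) by (rule std_BM_prob_space)
  obtain L \<kappa> N Bad where L: "1 \<le> L" and \<kappa>: "0 < \<kappa>"
    and Bad [measurable]: "\<And>n. N \<le> n \<Longrightarrow> Bad n \<in> sets MW"
    and prob_Bad: "\<And>n. N \<le> n \<Longrightarrow> prob (Bad n) \<le> (2 * real n + 1) * exp (- \<kappa> * real n)"
    and good: "\<And>n \<omega>. N \<le> n \<Longrightarrow> \<omega> \<in> space MW \<Longrightarrow> \<omega> \<notin> Bad n \<Longrightarrow>
      Xbar MB B0 W \<beta> a b a' b' a0 b0 t \<omega> \<le> ereal (L * real n)"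
    by (rule Xbar_exponential_tail[OF assms(1-9), of \<beta>]) blast
  \<comment> \<open>With about \<open>c * ln n powr q\<close> blocks, the bound \<open>L * m\<close>
    is at most half of the level \<open>ln n powr q\<close>, hence strictly below it.\<close>
  define c where "c = 1 / (2 * L)"
  have c: "0 < c" using L by (simp add: c_def)
  define X where "X \<omega> = Xbar MB B0 W \<beta> a b a' b' a0 b0 t \<omega>" for \<omega>
  have "(\<lambda>n::nat. real n powr p * prob {\<omega> \<in> space MW. X \<omega> \<ge> ereal ((ln (real n)) powr q)}) \<longlonglongrightarrow> 0"
  proof (rule tendsto_sandwich[OF _ _ tendsto_const tail_bound_tendsto_0[OF assms(10,11) \<kappa> c]])
    have "filterlim (\<lambda>n::nat. c * ln (real n) powr q) at_top sequentially"
      using c assms(11) by real_asymp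
    then have "\<forall>\<^sub>F n in sequentially. real N + 1 \<le> c * ln (real n) powr q"
      by (simp add: filterlim_at_top)
    then show "\<forall>\<^sub>F n in sequentially. real n powr p * prob {\<omega> \<in> space MW. X \<omega> \<ge> ereal ((ln (real n)) powr q)}
      \<le> real n powr p * ((2 * (c * ln (real n) powr q) + 1) * exp (- \<kappa> * (c * ln (real n) powr q - 1)))"
    proof eventually_elim
      case (elim n)
      define x where "x = c * ln (real n) powr q"
      define m where "m = nat \<lfloor>x\<rfloor>"
      have m: "real m \<le> x" "x - 1 \<le> real m" "N \<le> m"
        using elim unfolding x_def[symmetric] m_def by linarith+
      have "L * real m \<le> L * x" using m L by (intro mult_left_mono) auto
      also have "\<dots> < 2 * (L * x)" using L elim unfolding x_def[symmetric] by (simp add: zero_less_mult_iff)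
      also have "\<dots> = ln (real n) powr q" using L by (simp add: x_def c_def)
      finally have less: "L * real m < ln (real n) powr q" .
      have "{\<omega> \<in> space MW. X \<omega> \<ge> ereal (ln (real n) powr q)} \<subseteq> Bad m"
      proof
        fix \<omega> assume \<omega>: "\<omega> \<in> {\<omega> \<in> space MW. X \<omega> \<ge> ereal (ln (real n) powr q)}"
        show "\<omega> \<in> Bad m"
        proof (rule ccontr)
          assume "\<omega> \<notin> Bad m"
          then have "X \<omega> \<le> ereal (L * real m)" unfolding X_def using \<omega> m by (intro good) auto
          also have "\<dots> < ereal (ln (real n) powr q)" using less by simp
          finally show False using \<omega> by (simp add: not_le[symmetric])
        qed
      qed
      then have "prob {\<omega> \<in> space MW. X \<omega> \<ge> ereal (ln (real n) powr q)} \<le> prob (Bad m)"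
        using Bad[OF m(3)] by (rule finite_measure_mono)
      also have "\<dots> \<le> (2 * real m + 1) * exp (- \<kappa> * real m)" by (rule prob_Bad[OF m(3)])
      \<comment> \<open>Rounding down loses less than 1, which accounts for \<open>x - 1\<close> in
        the exponent.\<close>
      also have "\<dots> \<le> (2 * x + 1) * exp (- \<kappa> * (x - 1))"
        using m \<kappa> by (intro mult_mono) auto
      finally show ?case unfolding x_def by (intro mult_left_mono) auto
    qed
  qed auto
  moreover have "(\<integral>\<^sup>+ \<omega>. e2ennreal (X \<omega>) ^ j \<partial>MW) < \<infinity>" for j
  proof -
    \<comment> \<open>Indexed by \<open>Suc n\<close> because the summand of a bad \<open>n\<close>
      has to dominate the value bounded at the next index. Being at least 1, the terms diverge if
      every index is bad.\<close>
    define f where "f n = (L * real (Suc n)) ^ j" for n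
    have f1: "1 \<le> f n" for n
      unfolding f_def using L mult_mono[of 1 L 1 "real (Suc n)"] by (intro one_le_power) auto
    define U where "U \<omega> = ennreal ((L * real N) ^ j) + (\<Sum>m. ennreal (f (N + m)) * indicator (Bad (N + m)) \<omega>)" for \<omega>
    \<comment> \<open>If \<open>n\<close> is the first index from \<open>N\<close> on with \<open>\<omega> \<notin> Bad n\<close>, then either \<open>n = N\<close> or the summand of
      \<open>n - 1\<close> dominates; if there is no such index, the series diverges.\<close>
    have "e2ennreal (X \<omega>) ^ j \<le> U \<omega>" if \<omega>: "\<omega> \<in> space MW" for \<omega>
    proof (cases "\<exists>n\<ge>N. \<omega> \<notin> Bad n")
      case True
      define n where "n = (LEAST n. N \<le> n \<and> \<omega> \<notin> Bad n)"
      have n: "N \<le> n" "\<omega> \<notin> Bad n" using LeastI_ex[OF True[unfolded Bex_def]] by (auto simp: n_def)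
      have "X \<omega> \<le> ereal (L * real n)" unfolding X_def by (rule good[OF n(1) \<omega> n(2)])
      then have "e2ennreal (X \<omega>) \<le> e2ennreal (ereal (L * real n))" by (rule e2ennreal_mono)
      then have "e2ennreal (X \<omega>) ^ j \<le> ennreal (L * real n) ^ j"
        by (intro power_mono) (auto simp: ennreal.abs_eq)
      also have "\<dots> = ennreal ((L * real n) ^ j)" using L by (simp add: ennreal_power)
      also have "\<dots> \<le> U \<omega>"
      proof (cases "n = N")
        case True
        then show ?thesis by (simp add: U_def)
      next
        case False
        then obtain m where m: "n = Suc (N + m)" using n(1) by (metis add_Suc_right le_neq_implies_less less_iff_Suc_add)
        have "\<omega> \<in> Bad (N + m)"
          using not_less_Least[of "N + m" "\<lambda>n. N \<le> n \<and> \<omega> \<notin> Bad n"] m by (auto simp: n_def[symmetric])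
        then have "ennreal ((L * real n) ^ j) = (\<Sum>i\<in>{m}. ennreal (f (N + i)) * indicator (Bad (N + i)) \<omega>)"
          by (simp add: f_def m)
        also have "\<dots> \<le> (\<Sum>i. ennreal (f (N + i)) * indicator (Bad (N + i)) \<omega>)"
          by (intro sum_le_suminf) auto
        also have "\<dots> \<le> U \<omega>" by (simp add: U_def)
        finally show ?thesis .
      qed
      finally show ?thesis .
    next
      case False
      then have "(\<Sum>m. ennreal (f (N + m)) * indicator (Bad (N + m)) \<omega>) = \<infinity>"
        using f1 by (intro suminf_ennreal_eq_top) auto
      then show ?thesis by (simp add: U_def)
    qed
    then have "(\<integral>\<^sup>+ \<omega>. e2ennreal (X \<omega>) ^ j \<partial>MW) \<le> (\<integral>\<^sup>+ \<omega>. U \<omega> \<partial>MW)"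
      by (rule nn_integral_mono)
    \<comment> \<open>Termwise integration turns the indicators into probabilities of
      \<open>Bad\<close>, which decay exponentially against the polynomial weights.\<close>
    also have "\<dots> = ennreal ((L * real N) ^ j) + (\<Sum>m. ennreal (f (N + m)) * emeasure MW (Bad (N + m)))"
      unfolding U_def
      by (simp add: nn_integral_add nn_integral_suminf nn_integral_cmult emeasure_space_1)
    also have "\<dots> \<le> ennreal ((L * real N) ^ j) +
        (\<Sum>m. ennreal (f (N + m) * ((2 * real (N + m) + 1) * exp (- \<kappa> * real (N + m)))))"
    proof (intro add_left_mono suminf_le)
      fix m
      have "f (N + m) * prob (Bad (N + m)) \<le> f (N + m) * ((2 * real (N + m) + 1) * exp (- \<kappa> * real (N + m)))"
        using order_trans[OF zero_le_one f1] by (intro mult_left_mono prob_Bad) auto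
      then show "ennreal (f (N + m)) * emeasure MW (Bad (N + m))
        \<le> ennreal (f (N + m) * ((2 * real (N + m) + 1) * exp (- \<kappa> * real (N + m))))"
        using order_trans[OF zero_le_one f1]
        by (simp add: emeasure_eq_measure ennreal_mult'[symmetric] ennreal_leI)
    qed auto
    also have "\<dots> < \<infinity>"
    proof -
      define g where "g n = f n * ((2 * real n + 1) * exp (- \<kappa> * real n))" for n
      have "summable g" unfolding g_def f_def by (rule summable_poly_exp[OF \<kappa> L])
      then have "summable (\<lambda>m. g (N + m))" by (subst add.commute) (rule summable_ignore_initial_segment)
      moreover have "0 \<le> g n" for n using order_trans[OF zero_le_one f1] by (simp add: g_def)
      ultimately have "(\<Sum>m. ennreal (g (N + m))) = ennreal (\<Sum>m. g (N + m))"
        by (intro suminf_ennreal2) auto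
      then show ?thesis unfolding g_def[symmetric] by simp
    qed
    finally show ?thesis .
  qed
  ultimately show ?thesis unfolding X_def by blast
qed

end
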